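(* Let $N_0,\dots,N_d$ be nonnegative integers with $\sum_jN_j=n$, $p=(p_0,\dots,p_d)$ with $p_j=N_j/n$, and $p_{\min}=\min_jp_j$. Let $\pi^d$ be the marginal distribution of $(\theta_1,\dots,\theta_d)$ when $(\theta_0,\theta_1,\dots,\theta_d)\sim\pi=\mathrm{Dir}(N_0+1,N_1+1,\dots,N_d+1)$, and let $\hat\gamma^d$ be the Laplace approximation to $\pi^d$, which is given by the marginal distribution of $(X_1,\dots,X_d)$ when $(X_0,X_1,\dots,X_d)\sim\hat\gamma=\mathcal N\big(p,n^{-1}(\mathrm{diag}(p)-pp^\top)\big)$. If $p_{\min}\ge6/\sqrt{n+d}$ and $\mathrm{TV}(\mathrm{Unif}_{d+1},p)\ge6/(d+1)$, then $$\mathrm{TV}(\pi^d,\hat\gamma^d)\ge\frac19\,\mathrm{TV}(\mathrm{Unif}_{d+1},p)\,\frac{d}{\sqrt n},$$ where $\mathrm{TV}(\mathrm{Unif}_{d+1},p)=\frac12\sum_{j=0}^d\big|\frac1{d+1}-p_j\big|$.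
   Context: $\mathrm{Dir}$ denotes the Dirichlet distribution on the probability simplex in $\mathbb R^{d+1}$. $\mathrm{Unif}_{d+1}$ is the uniform probability mass function on $d+1$ states. $\mathrm{TV}(\mu,\nu)=\sup_A|\mu(A)-\nu(A)|$ over Borel sets. The Laplace approximation of a density $\propto e^{-V}$ with unique minimizer $\hat x$ of $V$ is $\mathcal N(\hat x,\nabla^2V(\hat x)^{-1})$. *)

theory Defs
  imports "HOL-Probability.Probability"
begin

text \<open>
  For a finite index type \<open>'d\<close> with \<open>CARD('d) = d\<close>, the coordinates \<open>1, \<dots>, d\<close> are the elements
  of \<open>'d\<close> and the coordinates \<open>0, 1, \<dots>, d\<close> are the elements of \<open>'d option\<close>, with \<open>None\<close> in the
  role of \<open>0\<close>.
\<close>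

definition drop0 :: "real ^ ('d::finite option) \<Rightarrow> real ^ 'd" where
  "drop0 x = (\<chi> j. x $ Some j)"

definition marginal0 :: "(real ^ ('d::finite option)) measure \<Rightarrow> (real ^ 'd) measure" where
  "marginal0 M = distr M borel drop0"

definition simplex_point :: "real ^ ('d::finite) \<Rightarrow> real ^ ('d option)" where
  "simplex_point x = (\<chi> j. case j of None \<Rightarrow> 1 - (\<Sum>i\<in>UNIV. x $ i) | Some i \<Rightarrow> x $ i)"

text \<open>
  The Dirichlet density with respect to Lebesgue measure in the coordinates \<open>(\<theta>\<^sub>1, \<dots>, \<theta>\<^sub>d)\<close>.
  It is set to zero on the (null) boundary of the simplex because \<open>0 powr 0 = 0\<close>.
\<close>
definition dirichlet_density :: "real ^ ('d::finite option) \<Rightarrow> real ^ 'd \<Rightarrow> real" where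
  "dirichlet_density \<alpha> x =
    (if \<forall>j. 0 < simplex_point x $ j
     then Gamma (\<Sum>j\<in>UNIV. \<alpha> $ j) / (\<Prod>j\<in>UNIV. Gamma (\<alpha> $ j)) *
            (\<Prod>j\<in>UNIV. simplex_point x $ j powr (\<alpha> $ j - 1))
     else 0)"

definition dirichlet :: "real ^ ('d::finite option) \<Rightarrow> (real ^ ('d option)) measure" where
  "dirichlet \<alpha> = distr (density lborel (\<lambda>x. ennreal (dirichlet_density \<alpha> x))) borel simplex_point"

definition std_gaussian :: "(real ^ 'n::finite) measure" where
  "std_gaussian = density lborel (\<lambda>x. ennreal (\<Prod>i\<in>UNIV. std_normal_density (x $ i)))"

text \<open>
  \<open>\<N>(m, \<Sigma>)\<close> as the law of \<open>m + A Z\<close>, where \<open>Z\<close> is standard normal and \<open>A A\<^sup>T = \<Sigma>\<close>. The law does not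
  depend on the choice of \<open>A\<close>, and \<open>\<Sigma>\<close> may be any positive semidefinite matrix, singular ones included.
\<close>
definition gaussian :: "real ^ 'n \<Rightarrow> real ^ 'n ^ 'n \<Rightarrow> (real ^ 'n::finite) measure" where
  "gaussian m S = distr std_gaussian borel
     (\<lambda>z. m + (SOME A :: real ^ 'n ^ 'n. A ** transpose A = S) *v z)"

definition gradient :: "(real ^ 'n::finite \<Rightarrow> real) \<Rightarrow> real ^ 'n \<Rightarrow> real ^ 'n" where
  "gradient V x = (\<chi> i. frechet_derivative V (at x) (axis i 1))"

definition hessian :: "(real ^ 'n::finite \<Rightarrow> real) \<Rightarrow> real ^ 'n \<Rightarrow> real ^ 'n ^ 'n" where
  "hessian V x = jacobian (gradient V) (at x)"

text \<open>
  The Laplace approximation of a density \<open>f = e\<^sup>-\<^sup>V\<close>. Here \<open>V = - ln f\<close> where \<open>f > 0\<close>, and \<open>V = \<infinity>\<close>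
  elsewhere, so that the minimum is taken over the set where \<open>f > 0\<close>. The normalising constant
  of \<open>f\<close> shifts \<open>V\<close> by a constant and therefore does not matter.
\<close>
definition laplace_approx :: "(real ^ 'n::finite \<Rightarrow> real) \<Rightarrow> (real ^ 'n) measure" where
  "laplace_approx f =
    (let V = (\<lambda>x. - ln (f x));
         xhat = (THE x. 0 < f x \<and> (\<forall>y. 0 < f y \<and> y \<noteq> x \<longrightarrow> V x < V y))
     in gaussian xhat (matrix_inv (hessian V xhat)))"

text \<open>Total variation distance of two probability measures on the same \<open>\<sigma>\<close>-algebra.\<close>
definition tv_dist :: "'a measure \<Rightarrow> 'a measure \<Rightarrow> real" where
  "tv_dist M N = (SUP A\<in>sets M. \<bar>measure M A - measure N A\<bar>)"

lemma drop0_simplex_point [simp]: "drop0 (simplex_point x) = x"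
  by (simp add: drop0_def simplex_point_def vec_eq_iff)

lemma borel_measurable_vec_lambda:
  fixes f :: "'a \<Rightarrow> real ^ 'n::finite"
  assumes "\<And>i. (\<lambda>x. f x $ i) \<in> borel_measurable M"
  shows "f \<in> borel_measurable M"
proof (rule borel_measurable_euclidean_space[THEN iffD2], intro ballI)
  fix b :: "real ^ 'n" assume "b \<in> Basis"
  then obtain i where "b = axis i 1"
    by (auto simp: Basis_vec_def)
  then show "(\<lambda>x. f x \<bullet> b) \<in> borel_measurable M"
    using assms[of i] by (simp add: inner_axis)
qed

lemma borel_measurable_drop0 [measurable]: "drop0 \<in> borel \<rightarrow>\<^sub>M borel"
  by (rule borel_measurable_vec_lambda) (simp add: drop0_def)

lemma borel_measurable_simplex_point [measurable]: "simplex_point \<in> borel \<rightarrow>\<^sub>M borel"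
proof (rule borel_measurable_vec_lambda)
  show "(\<lambda>x. simplex_point x $ j) \<in> borel_measurable borel" for j :: "'a option"
    by (cases j) (simp_all add: simplex_point_def)
qed

lemma marginal0_dirichlet:
  "marginal0 (dirichlet \<alpha>) = density lborel (\<lambda>x. ennreal (dirichlet_density \<alpha> x))"
proof -
  let ?D = "density lborel (\<lambda>x. ennreal (dirichlet_density \<alpha> x))"
  have "marginal0 (dirichlet \<alpha>) = distr ?D borel (drop0 \<circ> simplex_point)"
    unfolding marginal0_def dirichlet_def by (rule distr_distr) simp_all
  also have "\<dots> = distr ?D ?D (\<lambda>x. x)"
    by (rule distr_cong) simp_all
  finally show ?thesis
    by simp
qed

end

theory Submission
  imports Defs
begin

text \<open>
  Let \<open>A\<close> be the set of states with \<open>p\<^sub>j < 1 / (d + 1)\<close>, \<open>x = p(A)\<close> and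
  \<open>s = (d + 1) TV(Unif, p) = |A| - (d + 1) x\<close>. The two laws are compared on the half-space
  \<open>{\<theta>. \<theta>(A) > x}\<close>, to which the Gaussian gives mass at most \<open>1/2\<close> by symmetry about its mean. Under
  the Dirichlet law \<open>\<theta>(A)\<close> is a Beta variable, so the mass of the half-space is
  \<open>P(X \<le> h)\<close> for \<open>X\<close> binomial with \<open>n + d\<close> trials and success probability \<open>x\<close>, where
  \<open>h = E X + s + x - 1\<close>. A median of \<open>X\<close> is at most \<open>\<lceil>E X\<rceil>\<close>, and since the assumptions place \<open>h\<close> within
  a sixth of a standard deviation of the mean, each of the more than \<open>s - 2\<close> values between
  \<open>\<lceil>E X\<rceil>\<close> and \<open>h\<close> has probability of order \<open>1 / sqrt (n + d)\<close>.
\<close>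

section \<open>Binomial probabilities\<close>

text \<open>The Gaussian is centred at the mode p, whereas the Dirichlet mean of coordinate j is
  (N_j + 1) / (n + d + 1), pulled from p towards the uniform law. The mean of \<theta>(A) exceeds x
  by s / (n + d + 1), and among all sets of states A makes this excess largest; the half-space
  detects this shift. As x (1 - x) \<le> 1/4, a standard deviation of X is at most sqrt (n + d) / 2,
  so no factor depending on x is left in the bound. A separate obstacle lies on the Gaussian side:
  \<open>gaussian\<close> uses an unspecified square root of the covariance, and the covariance in d
  + 1 coordinates is singular. Identifying its marginal with the Laplace approximation therefore
  requires that the law of B Z depend on B B^T only, which is derived from rotation invariance. The
  constant is 1/9 = (3/25) / (27/25), where 3/25 comes from the binomial estimate and 27/25 bounds
  sqrt ((n + d) / n).\<close>

text \<open>The ratio of consecutive binomial probabilities, cleared of denominators so that it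
  holds for all j, also beyond n, and for all x. Every comparison of binomial probabilities below
  rests on it.\<close>

lemma Bernstein_Suc:
  "real (Suc j) * (1 - x) * Bernstein n (Suc j) x = (real n - real j) * x * Bernstein n j x"
proof (cases "j < n")
  case True
  then have "n - j = Suc (n - Suc j)" by simp
  then have e: "(1 - x) ^ (n - j) = (1 - x) * (1 - x) ^ (n - Suc j)"
    by (metis power_Suc)
  have "Suc j * (n choose Suc j) = (n - j) * (n choose j)"
    by (metis True Suc_times_binomial_eq add_diff_cancel_left' binomial_absorb_comp binomial_absorption
        diff_Suc_1 less_imp_Suc_add mult.commute)
  then have c: "real (Suc j) * real (n choose Suc j) = (real n - real j) * real (n choose j)"
    using True by (metis less_imp_le of_nat_diff of_nat_mult)
  show ?thesis
  proof -
    have "real (Suc j) * (1 - x) * Bernstein n (Suc j) x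
      = (real (Suc j) * real (n choose Suc j)) * (x * x ^ j * ((1 - x) * (1 - x) ^ (n - Suc j)))"
      by (simp add: Bernstein_def)
    also have "\<dots> = (real n - real j) * x * Bernstein n j x"
      unfolding c by (simp add: Bernstein_def e)
    finally show ?thesis .
  qed
next
  case False
  then show ?thesis by (cases "j = n") (auto simp: Bernstein_def binomial_eq_0)
qed

lemma Bernstein_eq_0: "n < j \<Longrightarrow> Bernstein n j x = 0"
  by (simp add: Bernstein_def)

lemma Bernstein_variance:
  "(\<Sum>j\<le>n. (real j - real n * x)\<^sup>2 * Bernstein n j x) = real n * x * (1 - x)"
proof -
  have "(\<Sum>j\<le>n. (real j - real n * x)\<^sup>2 * Bernstein n j x)
    = (\<Sum>j\<le>n. real j * (real j - 1) * Bernstein n j x + (1 - 2 * (real n * x)) * (real j * Bernstein n j x)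
        + (real n * x)\<^sup>2 * Bernstein n j x)"
    by (rule sum.cong) (auto simp: power2_eq_square algebra_simps)
  also have "\<dots> = real n * (real n - 1) * x\<^sup>2 + (1 - 2 * (real n * x)) * (real n * x) + (real n * x)\<^sup>2"
    by (simp add: sum.distrib flip: sum_distrib_left)
  finally show ?thesis by (simp add: power2_eq_square algebra_simps)
qed

text \<open>The ratio P(X = j + 1) / P(X = j) is at most 1 exactly if n x \<le> j + 1 - x, which
  holds from the mean onwards.\<close>

lemma Bernstein_antimono:
  assumes x: "0 < x" "x < 1" and i: "real n * x \<le> real i" "i \<le> j"
  shows "Bernstein n j x \<le> Bernstein n i x"
  using i(2)
proof (induction j rule: dec_induct)
  case (step j)
  have "real (Suc j) * (1 - x) * Bernstein n (Suc j) x = (real n - real j) * x * Bernstein n j x"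
    by (rule Bernstein_Suc)
  also have "\<dots> \<le> real (Suc j) * (1 - x) * Bernstein n j x"
  proof (rule mult_right_mono)
    have "real n * x \<le> real j" using i step by linarith
    then show "(real n - real j) * x \<le> real (Suc j) * (1 - x)"
      using x by (simp add: algebra_simps)
    show "0 \<le> Bernstein n j x" using x by (intro Bernstein_nonneg) auto
  qed
  finally have "Bernstein n (Suc j) x \<le> Bernstein n j x"
    using x by (simp add: mult_le_cancel_left_pos del: of_nat_Suc)
  then show ?case using step by linarith
qed simp

text \<open>The subtracted factor (j - n x)^2 / (\<kappa> s)^2 exceeds 1 outside the window and is
  nonnegative inside, so the window keeps at least the total mass minus the variance over (\<kappa>
  s)^2.\<close>

lemma Bernstein_chebyshev:
  assumes x: "0 < x" "x < 1" and n: "0 < n" and \<kappa>: "0 < \<kappa>"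
  defines "s \<equiv> sqrt (real n * x * (1 - x))"
  shows "1 - 1 / \<kappa>\<^sup>2 \<le> (\<Sum>j | j \<le> n \<and> \<bar>real j - real n * x\<bar> \<le> \<kappa> * s. Bernstein n j x)"
proof -
  have s: "0 < s" "s\<^sup>2 = real n * x * (1 - x)"
    using x n by (auto simp: s_def)
  have b: "0 \<le> Bernstein n j x" for j using x by (intro Bernstein_nonneg) auto
  have "(\<Sum>j\<le>n. Bernstein n j x - (real j - real n * x)\<^sup>2 * Bernstein n j x / (\<kappa> * s)\<^sup>2)
      \<le> (\<Sum>j\<le>n. if \<bar>real j - real n * x\<bar> \<le> \<kappa> * s then Bernstein n j x else 0)"
  proof (rule sum_mono)
    fix j
    show "Bernstein n j x - (real j - real n * x)\<^sup>2 * Bernstein n j x / (\<kappa> * s)\<^sup>2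
      \<le> (if \<bar>real j - real n * x\<bar> \<le> \<kappa> * s then Bernstein n j x else 0)"
    proof (cases "\<bar>real j - real n * x\<bar> \<le> \<kappa> * s")
      case False
      then have "(\<kappa> * s)\<^sup>2 \<le> \<bar>real j - real n * x\<bar>\<^sup>2"
        using s \<kappa> by (intro power_mono) auto
      then have "(\<kappa> * s)\<^sup>2 * Bernstein n j x \<le> (real j - real n * x)\<^sup>2 * Bernstein n j x"
        using b by (intro mult_right_mono) auto
      then have "Bernstein n j x \<le> (real j - real n * x)\<^sup>2 * Bernstein n j x / (\<kappa> * s)\<^sup>2"
        using s \<kappa> by (simp add: pos_le_divide_eq mult.commute)
      with False show ?thesis by simp
    qed (use b in auto)
  qed
  also have "\<dots> = (\<Sum>j | j \<le> n \<and> \<bar>real j - real n * x\<bar> \<le> \<kappa> * s. Bernstein n j x)"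
    by (simp add: sum.If_cases flip: sum.inter_filter) (rule sum.cong, auto)
  also have "(\<Sum>j\<le>n. Bernstein n j x - (real j - real n * x)\<^sup>2 * Bernstein n j x / (\<kappa> * s)\<^sup>2)
     = 1 - s\<^sup>2 / (\<kappa> * s)\<^sup>2"
    by (simp add: sum_subtractf Bernstein_variance s flip: sum_divide_distrib)
  also have "\<dots> = 1 - 1 / \<kappa>\<^sup>2"
    using s(1) by (simp add: power_mult_distrib)
  finally show ?thesis .
qed

lemma finite_nat_interval: "finite {j::nat. a \<le> real j \<and> real j \<le> b}"
  by (rule finite_subset[of _ "{..nat \<lfloor>b\<rfloor>}"]) (auto simp: le_nat_floor)

lemma card_nat_interval_le:
  fixes a w :: real
  assumes "0 \<le> w"
  shows "real (card {j::nat. a \<le> real j \<and> real j \<le> a + w}) \<le> w + 1"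
proof -
  have "card {j::nat. a \<le> real j \<and> real j \<le> a + w} \<le> card {\<lceil>a\<rceil>..\<lfloor>a + w\<rfloor>}"
    by (rule card_inj_on_le[where f = int]) (auto simp: ceiling_le_iff le_floor_iff)
  then have "real (card {j::nat. a \<le> real j \<and> real j \<le> a + w}) \<le> real (nat (\<lfloor>a + w\<rfloor> - \<lceil>a\<rceil> + 1))"
    by simp
  also have "\<dots> \<le> w + 1" using assms by linarith
  finally show ?thesis .
qed

text \<open>The values m - i and m + 1 + i are mirror images about m + 1/2. Multiplying the step
  ratios on the two sides pairs their linear factors into differences of squares, for instance (m +
  2 + i) (m - i) = (m + 1)^2 - (i + 1)^2. Hence the change of the ratio between mirror images
  depends on i through (i + 1)^2 only.\<close>

lemma Bernstein_reflected_ratio: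
  assumes i: "i < m"
  shows "((real m + 1)\<^sup>2 - (real i + 1)\<^sup>2) * (1 - x)\<^sup>2 * (Bernstein n (m + 1 + Suc i) x * Bernstein n (m - i) x)
     = ((real n - real m)\<^sup>2 - (real i + 1)\<^sup>2) * x\<^sup>2 * (Bernstein n (m - Suc i) x * Bernstein n (m + 1 + i) x)"
proof -
  define u u' v v' where d: "u = Bernstein n (m - i) x" "u' = Bernstein n (m - Suc i) x"
    "v = Bernstein n (m + 1 + i) x" "v' = Bernstein n (m + 1 + Suc i) x"
  have 1: "(real m + 2 + real i) * (1 - x) * v' = (real n - real m - 1 - real i) * x * v"
    using Bernstein_Suc[of "m + 1 + i" x n] by (simp add: d algebra_simps)
  have 2: "(real m - real i) * (1 - x) * u = (real n - real m + real i + 1) * x * u'"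
    using Bernstein_Suc[of "m - Suc i" x n] i by (simp add: d Suc_diff_Suc of_nat_diff algebra_simps)
  have "((real m + 1)\<^sup>2 - (real i + 1)\<^sup>2) * (1 - x)\<^sup>2 * (v' * u)
      = ((real m + 2 + real i) * (1 - x) * v') * ((real m - real i) * (1 - x) * u)"
    by (simp add: power2_eq_square algebra_simps)
  also have "\<dots> = ((real n - real m - 1 - real i) * x * v) * ((real n - real m + real i + 1) * x * u')"
    using 1 2 by simp
  also have "\<dots> = ((real n - real m)\<^sup>2 - (real i + 1)\<^sup>2) * x\<^sup>2 * (u' * v)"
    by (simp add: power2_eq_square algebra_simps)
  finally show ?thesis unfolding d .
qed

text \<open>With \<open>u\<^sub>i = P(X = m - i)\<close> and \<open>v\<^sub>i = P(X = m + 1 + i)\<close>, the differences \<open>u\<^sub>i - v\<^sub>i\<close> change sign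
  at most once, from nonnegative to nonpositive, because the ratios \<open>v\<^sub>i / u\<^sub>i\<close> cannot decrease again once
  they have increased. As their sum with the increasing weights \<open>i + 1/2\<close> is \<open>m + 1/2 - E X > 0\<close>, their
  unweighted sum is positive too.\<close>

lemma Bernstein_median:
  assumes x: "0 < x" "x < 1" and m: "real n * x \<le> real m" "m \<le> n"
  shows "1 / 2 \<le> (\<Sum>j\<le>m. Bernstein n j x)"
proof -
  define u where "u i = (if i \<le> m then Bernstein n (m - i) x else 0)" for i
  define v where "v i = Bernstein n (m + 1 + i) x" for i
  \<comment> \<open>For i < m, \<open>S i\<close> says that v / u does not increase from i to i +
    1.\<close>
  define S where "S i \<longleftrightarrow> ((real n - real m)\<^sup>2 - (real i + 1)\<^sup>2) * x\<^sup>2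
      \<le> ((real m + 1)\<^sup>2 - (real i + 1)\<^sup>2) * (1 - x)\<^sup>2" for i
  have nn: "0 \<le> u i" "0 \<le> v i" for i
    using x by (auto simp: u_def v_def intro!: Bernstein_nonneg)
  have upos: "0 < u i" if "i \<le> m" for i
    using x that m by (auto simp: u_def intro!: Bernstein_pos)
  have ratio: "((real m + 1)\<^sup>2 - (real i + 1)\<^sup>2) * (1 - x)\<^sup>2 * (v (Suc i) * u i)
      = ((real n - real m)\<^sup>2 - (real i + 1)\<^sup>2) * x\<^sup>2 * (u (Suc i) * v i)" if "i < m" for i
    using Bernstein_reflected_ratio[OF that, of x n] that by (simp add: u_def v_def)
  have P: "0 < ((real m + 1)\<^sup>2 - (real i + 1)\<^sup>2) * (1 - x)\<^sup>2" if "i < m" for i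
  proof -
    have "(real i + 1)\<^sup>2 < (real m + 1)\<^sup>2"
      using that by (intro power_strict_mono) auto
    then show ?thesis using x by simp
  qed
  have step: "v (Suc i) * u i \<le> u (Suc i) * v i" if "i < m" "S i" for i
  proof -
    have "((real n - real m)\<^sup>2 - (real i + 1)\<^sup>2) * x\<^sup>2 * (u (Suc i) * v i)
      \<le> ((real m + 1)\<^sup>2 - (real i + 1)\<^sup>2) * (1 - x)\<^sup>2 * (u (Suc i) * v i)"
      using that(2) nn unfolding S_def by (intro mult_right_mono) auto
    then show ?thesis
      unfolding ratio[OF that(1), symmetric] by (rule mult_left_le_imp_le[OF _ P[OF that(1)]])
  qed
  have step': "u (Suc i) * v i \<le> v (Suc i) * u i" if "i < m" "\<not> S i" for i
  proof -
    have "((real m + 1)\<^sup>2 - (real i + 1)\<^sup>2) * (1 - x)\<^sup>2 * (u (Suc i) * v i)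
      \<le> ((real n - real m)\<^sup>2 - (real i + 1)\<^sup>2) * x\<^sup>2 * (u (Suc i) * v i)"
      using that(2) nn unfolding S_def by (intro mult_right_mono) auto
    then show ?thesis
      unfolding ratio[OF that(1), symmetric] by (rule mult_left_le_imp_le[OF _ P[OF that(1)]])
  qed
  \<comment> \<open>\<open>S i\<close> has the form C \<le> (i + 1)^2 (x^2 - (1 - x)^2), where C
    \<le> 0 because n x \<le> m. For x \<ge> 1/2 it always holds; for x < 1/2 the right-hand side
    decreases in i, so a failure persists.\<close>
  have S_mono: "\<not> S j" if "\<not> S i" "i \<le> j" for i j
  proof
    assume "S j"
    have "(real n - real m) * x \<le> (real m + 1) * (1 - x)"
      using m x by (simp add: algebra_simps)
    then have "((real n - real m) * x)\<^sup>2 \<le> ((real m + 1) * (1 - x))\<^sup>2"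
      using m x by (intro power_mono) auto
    then have 1: "(real n - real m)\<^sup>2 * x\<^sup>2 - (real m + 1)\<^sup>2 * (1 - x)\<^sup>2 \<le> 0"
      by (simp add: power_mult_distrib)
    have ij: "(real i + 1)\<^sup>2 \<le> (real j + 1)\<^sup>2"
      using that by (intro power_mono) auto
    have S': "S i \<longleftrightarrow> (real n - real m)\<^sup>2 * x\<^sup>2 - (real m + 1)\<^sup>2 * (1 - x)\<^sup>2 \<le> (real i + 1)\<^sup>2 * (x\<^sup>2 - (1 - x)\<^sup>2)" for i
      unfolding S_def by (simp add: algebra_simps)
    show False
    proof (cases "0 \<le> x\<^sup>2 - (1 - x)\<^sup>2")
      case True
      then have "0 \<le> (real i + 1)\<^sup>2 * (x\<^sup>2 - (1 - x)\<^sup>2)" by simp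
      then show False using 1 \<open>\<not> S i\<close> S'[of i] by linarith
    next
      case False
      then have "(real j + 1)\<^sup>2 * (x\<^sup>2 - (1 - x)\<^sup>2) \<le> (real i + 1)\<^sup>2 * (x\<^sup>2 - (1 - x)\<^sup>2)"
        using ij by (intro mult_right_mono_neg) auto
      then show False using \<open>S j\<close> \<open>\<not> S i\<close> S' by (meson order_trans)
    qed
  qed
  \<comment> \<open>The place of the sign change. The alternative \<open>Suc m\<close> makes the
    least element exist even if u \<ge> v all the way up to m; beyond m the sequence u is zero, so
    the sign is then right without further argument.\<close>
  define k where "k = (LEAST i. u i < v i \<or> i = Suc m)"
  have k: "u k < v k \<or> k = Suc m"
    unfolding k_def by (rule LeastI[of _ "Suc m"]) simp
  have before: "v i \<le> u i" if "i < k" for i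
    using not_less_Least[of i "\<lambda>i. u i < v i \<or> i = Suc m"] that by (auto simp: k_def)
  have after: "u i \<le> v i" if "k \<le> i" for i
  proof (cases "m < i")
    case True
    then show ?thesis using nn by (simp add: u_def)
  next
    case False
    then have km: "k \<le> m" "u k < v k" using that k by auto
    have "k \<noteq> 0"
    proof
      assume "k = 0"
      have "v 0 \<le> u 0"
        using Bernstein_antimono[OF x m(1), of "m + 1"] by (simp add: u_def v_def)
      then show False using km \<open>k = 0\<close> by simp
    qed
    then obtain k' where k': "k = Suc k'" by (cases k) auto
    \<comment> \<open>Going from v \<le> u at \<open>k'\<close> to u < v at \<open>k\<close> forces
      v / u to increase there, which \<open>S k'\<close> would exclude.\<close>
    have "\<not> S k'"
    proof
      assume "S k'"
      then have "v k * u k' \<le> u k * v k'" using step[of k'] km k' by simp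
      also have "\<dots> \<le> u k * u k'" using before[of k'] k' nn by (intro mult_left_mono) auto
      finally have "v k \<le> u k" using upos[of k'] km k' by simp
      then show False using km by simp
    qed
    then have nS: "\<not> S j" if "k \<le> j" for j using S_mono that k' by simp
    have "i \<le> m \<longrightarrow> u i \<le> v i" using that
    proof (induction i rule: dec_induct)
      case (step j)
      show ?case
      proof
        assume j: "Suc j \<le> m"
        then have uv: "u j \<le> v j" using step by simp
        have "u (Suc j) * u j \<le> u (Suc j) * v j" using uv nn by (intro mult_left_mono) auto
        also have "\<dots> \<le> v (Suc j) * u j" using step'[of j] nS step j by simp
        finally show "u (Suc j) \<le> v (Suc j)" using upos[of j] j by simp
      qed
    qed (use km in simp)
    then show ?thesis using False by simp
  qed
  have low: "(\<Sum>i\<le>n. u i * f i) = (\<Sum>j\<le>m. Bernstein n j x * f (m - j))" for f :: "nat \<Rightarrow> real"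
  proof -
    have "(\<Sum>i\<le>n. u i * f i) = (\<Sum>i\<le>m. Bernstein n (m - i) x * f i)"
      using m by (intro sum.mono_neutral_cong_right) (auto simp: u_def)
    also have "\<dots> = (\<Sum>j\<le>m. Bernstein n j x * f (m - j))"
      by (rule sum.reindex_bij_witness[of _ "\<lambda>i. m - i" "\<lambda>i. m - i"]) auto
    finally show ?thesis .
  qed
  have high: "(\<Sum>i\<le>n. v i * f i) = (\<Sum>j\<in>{m<..n}. Bernstein n j x * f (j - m - 1))" for f :: "nat \<Rightarrow> real"
  proof -
    have "(\<Sum>i\<le>n. v i * f i) = (\<Sum>i | i \<le> n \<and> m + 1 + i \<le> n. Bernstein n (m + 1 + i) x * f i)"
      by (intro sum.mono_neutral_cong_right) (auto simp: v_def intro: Bernstein_eq_0)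
    also have "\<dots> = (\<Sum>j\<in>{m<..n}. Bernstein n j x * f (j - m - 1))"
      by (rule sum.reindex_bij_witness[of _ "\<lambda>j. j - m - 1" "\<lambda>i. m + 1 + i"]) auto
    finally show ?thesis .
  qed
  have split: "(\<Sum>j\<le>n. g j) = (\<Sum>j\<le>m. g j) + (\<Sum>j\<in>{m<..n}. g j)" for g :: "nat \<Rightarrow> real"
    using m by (subst sum.union_disjoint[symmetric]) (auto intro!: sum.cong)
  have "(real k + 1 / 2) * (\<Sum>i\<le>n. u i - v i) = (\<Sum>i\<le>n. (u i - v i) * (real k + 1 / 2))"
    by (simp add: sum_distrib_left mult.commute)
  also have "\<dots> \<ge> (\<Sum>i\<le>n. (u i - v i) * (real i + 1 / 2))"
  proof (rule sum_mono)
    fix i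
    show "(u i - v i) * (real i + 1 / 2) \<le> (u i - v i) * (real k + 1 / 2)"
    proof (cases "i < k")
      case True
      then show ?thesis using before[of i] by (intro mult_left_mono) auto
    next
      case False
      then show ?thesis using after[of i] by (intro mult_left_mono_neg) auto
    qed
  qed
  also (xtrans) have "(\<Sum>i\<le>n. (u i - v i) * (real i + 1 / 2))
      = (\<Sum>i\<le>n. u i * (real i + 1 / 2)) - (\<Sum>i\<le>n. v i * (real i + 1 / 2))"
    by (simp add: left_diff_distrib sum_subtractf)
  \<comment> \<open>The weight i + 1/2 is the distance of both m - i and m + 1 + i from m + 1/2.
    With the sign minus on the upper half it becomes the signed distance m + 1/2 - j on both halves,
    so the sum is an expectation.\<close>
  also have "\<dots> = (\<Sum>j\<le>n. Bernstein n j x * (real m + 1 / 2 - real j))"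
  proof -
    have "(\<Sum>j\<le>m. Bernstein n j x * (real (m - j) + 1 / 2)) = (\<Sum>j\<le>m. Bernstein n j x * (real m + 1 / 2 - real j))"
      by (rule sum.cong) (auto simp: of_nat_diff)
    moreover have "- (\<Sum>j\<in>{m<..n}. Bernstein n j x * (real (j - m - 1) + 1 / 2))
        = (\<Sum>j\<in>{m<..n}. Bernstein n j x * (real m + 1 / 2 - real j))"
      unfolding sum_negf[symmetric] by (rule sum.cong) (auto simp: of_nat_diff algebra_simps)
    ultimately show ?thesis unfolding low high split by linarith
  qed
  also have "\<dots> = (\<Sum>j\<le>n. (real m + 1 / 2) * Bernstein n j x - real j * Bernstein n j x)"
    by (rule sum.cong) (auto simp: algebra_simps)
  also have "\<dots> = real m + 1 / 2 - real n * x"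
    by (simp add: sum_subtractf flip: sum_distrib_left)
  finally have "0 < (real k + 1 / 2) * (\<Sum>i\<le>n. u i - v i)"
    using m by linarith
  then have "0 < (\<Sum>i\<le>n. u i - v i)"
    by (rule zero_less_mult_pos) simp
  then have "(\<Sum>j\<in>{m<..n}. Bernstein n j x) < (\<Sum>j\<le>m. Bernstein n j x)"
    using low[of "\<lambda>_. 1"] high[of "\<lambda>_. 1"] by (simp add: sum_subtractf)
  moreover have "(\<Sum>j\<le>m. Bernstein n j x) + (\<Sum>j\<in>{m<..n}. Bernstein n j x) = 1"
    using split[of "\<lambda>j. Bernstein n j x"] by simp
  ultimately show ?thesis by linarith
qed

text \<open>By Chebyshev, the values within two standard deviations of the mean have total mass at least \<open>3/4\<close>.
  None of them exceeds twice the value at \<open>h\<close>, since below \<open>h\<close> each step down multiplies by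
  at most \<open>\<rho> = 1 + O(s / \<sigma>\<^sup>2)\<close>.\<close>

lemma Bernstein_ge_above_mean:
  fixes x s D :: real
  assumes x: "0 < x" "x < 1" and h: "real h = real n * x + s + x - 1" "h \<le> n"
    and s: "6 \<le> s" "s \<le> D * (1 - x)" "D \<le> real n / 7" "36 * s\<^sup>2 \<le> real n * x * (1 - x)"
  shows "27 / 290 \<le> Bernstein n h x * sqrt (real n * x * (1 - x))"
proof -
  define \<sigma> where "\<sigma> = sqrt (real n * x * (1 - x))"
  define \<beta> where "\<beta> = Bernstein n h x"
  have "sqrt (36 * s\<^sup>2) \<le> \<sigma>"
    unfolding \<sigma>_def using s by (intro real_sqrt_le_mono) auto
  then have \<sigma>: "6 * s \<le> \<sigma>" using s by (simp add: real_sqrt_mult)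
  have n: "0 < n" using s \<sigma> by (cases "n = 0") (auto simp: \<sigma>_def)
  have \<sigma>2: "\<sigma>\<^sup>2 = real n * x * (1 - x)"
    using x by (simp add: \<sigma>_def)
  have b0: "0 \<le> Bernstein n j x" for j using x by (intro Bernstein_nonneg) auto
  \<comment> \<open>For j < h the ratio P(X = j) / P(X = j + 1) equals (j + 1) (1 - x) / ((n - j)
    x). It is largest at j = h - 1, where the denominator is \<open>q\<close> and the ratio is
    \<open>\<rho>\<close>.\<close>
  define q where "q = (real n - real h + 1) * x"
  define \<rho> where "\<rho> = real h * (1 - x) / q"
  \<comment> \<open>This is the purpose of \<open>D\<close>: since s \<le> D (1 - x) \<le> n (1 - x)
    / 7, the point h leaves at least 6/7 of the distance n (1 - x) between the mean and n.\<close>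
  have q: "6 / 7 * \<sigma>\<^sup>2 \<le> q"
  proof -
    have "s \<le> real n / 7 * (1 - x)"
      using s x by (intro order_trans[OF s(2)] mult_right_mono) auto
    moreover have "real n / 7 * (1 - x) = real n / 7 - real n * x / 7"
      "6 / 7 * (real n * (1 - x)) = 6 / 7 * real n - 6 / 7 * (real n * x)"
      by (simp_all add: field_simps)
    ultimately have "6 / 7 * (real n * (1 - x)) \<le> real n - real h + 1"
      using h x by linarith
    then have "6 / 7 * (real n * (1 - x)) * x \<le> q"
      unfolding q_def using x by (intro mult_right_mono) auto
    then show ?thesis by (simp add: \<sigma>2 algebra_simps)
  qed
  have q0: "0 < q"
  proof -
    have "0 < \<sigma>\<^sup>2" using \<sigma> s by simp
    then show ?thesis using q by linarith
  qed
  have \<rho>1: "\<rho> = 1 + (s - 1) / q"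
  proof -
    have "real h * (1 - x) = q + (s - 1)" unfolding q_def using h by (simp add: algebra_simps)
    then show ?thesis using q0 by (simp add: \<rho>_def add_divide_distrib)
  qed
  have "0 \<le> (s - 1) / q" using s q0 by simp
  then have \<rho>ge: "1 \<le> \<rho>" using \<rho>1 by simp
  have down: "Bernstein n j x \<le> \<beta> * \<rho> ^ (h - j)" if "j \<le> h" for j
    using that
  proof (induction j rule: inc_induct)
    case (step j)
    have j: "real (Suc j) \<le> real h" using step by (simp add: less_eq_Suc_le)
    have "(real n - real j) * x * Bernstein n j x = real (Suc j) * (1 - x) * Bernstein n (Suc j) x"
      by (rule Bernstein_Suc[symmetric])
    also have "\<dots> \<le> real h * (1 - x) * Bernstein n (Suc j) x"
      using j x b0 by (intro mult_right_mono) auto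
    also have "\<dots> = q * \<rho> * Bernstein n (Suc j) x"
      using q0 by (simp add: \<rho>_def)
    also have "\<dots> \<le> ((real n - real j) * x) * \<rho> * Bernstein n (Suc j) x"
      unfolding q_def using j x b0 \<rho>ge by (intro mult_right_mono) auto
    finally have "((real n - real j) * x) * Bernstein n j x \<le> ((real n - real j) * x) * (\<rho> * Bernstein n (Suc j) x)"
      by (simp add: mult.assoc)
    moreover have "0 < (real n - real j) * x" using j h x by simp
    ultimately have "Bernstein n j x \<le> \<rho> * Bernstein n (Suc j) x"
      by (simp only: mult_le_cancel_left_pos)
    also have "\<dots> \<le> \<rho> * (\<beta> * \<rho> ^ (h - Suc j))"
      using step \<rho>ge by (intro mult_left_mono) auto
    also have "\<dots> = \<beta> * \<rho> ^ (h - j)"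
      using step by (simp flip: Suc_diff_Suc)
    finally show ?case .
  qed (simp add: \<beta>_def)
  have two: "Bernstein n j x \<le> 2 * \<beta>" if "\<bar>real j - real n * x\<bar> \<le> 2 * \<sigma>" for j
  proof (cases "j \<le> h")
    case True
    define w where "w = real (h - j)"
    \<comment> \<open>Two standard deviations below the mean, plus h - n x \<le> s \<le> \<sigma> /
      6 above it.\<close>
    have w: "w \<le> 13 / 6 * \<sigma>" unfolding w_def using True that h x \<sigma> by (simp add: of_nat_diff)
    have "w * ((s - 1) / q) \<le> (13 / 6 * \<sigma>) * ((s - 1) / (6 / 7 * \<sigma>\<^sup>2))"
      using w q q0 s \<sigma> by (intro mult_mono divide_left_mono) (auto simp: zero_less_mult_iff)
    also have "\<dots> \<le> (13 / 6 * \<sigma>) * ((\<sigma> / 6) / (6 / 7 * \<sigma>\<^sup>2))"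
      using s \<sigma> by (intro mult_left_mono divide_right_mono) auto
    also have "\<dots> = 91 / 216"
      using s \<sigma> by (simp add: power2_eq_square)
    finally have e: "w * ((s - 1) / q) \<le> 1 / 2" by linarith
    have "\<rho> ^ (h - j) \<le> exp ((s - 1) / q) ^ (h - j)"
      using \<rho>ge unfolding \<rho>1 by (intro power_mono exp_ge_add_one_self) auto
    also have "\<dots> = exp (w * ((s - 1) / q))"
      unfolding w_def by (rule exp_of_nat_mult[symmetric])
    also have "\<dots> \<le> exp (1 / 2)" using e by simp
    also have "\<dots> \<le> 2" using exp_bound[of "1/2"] by (simp add: power2_eq_square)
    finally have "\<beta> * \<rho> ^ (h - j) \<le> \<beta> * 2"
      using b0 by (intro mult_left_mono) (auto simp: \<beta>_def)
    then show ?thesis using down[OF True] by simp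
  next
    case False
    have "real n * x \<le> real h" using h s x by simp
    then have "Bernstein n j x \<le> \<beta>"
      unfolding \<beta>_def using False x by (intro Bernstein_antimono) auto
    then show ?thesis using b0[of h] by (simp add: \<beta>_def)
  qed
  let ?J = "{j. j \<le> n \<and> \<bar>real j - real n * x\<bar> \<le> 2 * \<sigma>}"
  have "real (card ?J) \<le> real (card {j::nat. real n * x - 2 * \<sigma> \<le> real j \<and> real j \<le> (real n * x - 2 * \<sigma>) + 4 * \<sigma>})"
    by (intro of_nat_mono card_mono finite_nat_interval) auto
  also have "\<dots> \<le> 4 * \<sigma> + 1"
    using \<sigma> s by (intro card_nat_interval_le) auto
  finally have card: "real (card ?J) \<le> 4 * \<sigma> + 1" .
  have "3 / 4 \<le> (\<Sum>j\<in>?J. Bernstein n j x)"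
    using Bernstein_chebyshev[OF x n, of 2] by (simp add: \<sigma>_def)
  also have "\<dots> \<le> real (card ?J) * (2 * \<beta>)"
    using two by (intro sum_bounded_above) auto
  also have "\<dots> \<le> (4 * \<sigma> + 1) * (2 * \<beta>)"
    using card b0[of h] by (intro mult_right_mono) (auto simp: \<beta>_def)
  \<comment> \<open>From s \<ge> 6 one gets \<sigma> \<ge> 36, so the additional 1 costs at most
    \<sigma> / 36.\<close>
  also have "\<dots> \<le> (145 / 36 * \<sigma>) * (2 * \<beta>)"
    using \<sigma> s b0[of h] by (intro mult_right_mono) (auto simp: \<beta>_def)
  also have "\<dots> = 145 / 18 * (\<beta> * \<sigma>)" by simp
  finally have "27 / 290 \<le> \<beta> * \<sigma>" by linarith
  then show ?thesis by (simp add: \<sigma>_def \<beta>_def)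
qed

lemma Bernstein_sum_ge:
  fixes x s D :: real
  assumes x: "0 < x" "x < 1" and h: "real h = real n * x + s + x - 1" "h \<le> n"
    and s: "6 \<le> s" "s \<le> D * (1 - x)" "D \<le> real n / 7" "36 * s\<^sup>2 \<le> real n * x * (1 - x)"
  shows "1 / 2 + 3 / 25 * s / sqrt (real n) \<le> (\<Sum>j\<le>h. Bernstein n j x)"
proof -
  define m where "m = nat \<lceil>real n * x\<rceil>"
  have m: "real n * x \<le> real m" "real m < real n * x + 1"
    using x unfolding m_def by (auto simp: of_nat_ceiling ceiling_less_iff) linarith
  have mh: "m \<le> h" using m h x s by linarith
  define r where "r = sqrt (real n * x * (1 - x))"
  have "0 < s\<^sup>2" using s by simp
  then have n: "0 < n" using s(4) by (cases "n = 0") auto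
  have "0 \<le> (x - 1 / 2)\<^sup>2" by simp
  then have "x * (1 - x) \<le> 1 / 4" by (simp add: power2_eq_square algebra_simps)
  then have "real n * (x * (1 - x)) \<le> real n * (1 / 4)" by (intro mult_left_mono) auto
  then have "r \<le> sqrt (real n / 4)"
    unfolding r_def by (intro real_sqrt_le_mono) (simp add: mult.assoc)
  then have r: "r \<le> sqrt (real n) / 2" by (simp add: real_sqrt_divide)
  have b0: "0 \<le> Bernstein n j x" for j using x by (intro Bernstein_nonneg) auto
  have "27 / 290 \<le> Bernstein n h x * r"
    unfolding r_def by (rule Bernstein_ge_above_mean) (use assms in auto)
  also have "\<dots> \<le> Bernstein n h x * (sqrt (real n) / 2)"
    using r b0 by (intro mult_left_mono) auto
  finally have \<beta>: "27 / 145 / sqrt (real n) \<le> Bernstein n h x"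
    using n by (simp add: field_simps)
  \<comment> \<open>More than s + x - 2 integers lie in \<open>{m<..h}\<close>, and s - 2 \<ge> 2 s
    / 3 precisely because s \<ge> 6. The product (2/3) (27/145) = 18/145 is slightly larger than
    3/25.\<close>
  have "3 / 25 * s / sqrt (real n) \<le> (2 / 3 * s) * (27 / 145 / sqrt (real n))"
    using s n by (simp add: field_simps)
  also have "\<dots> \<le> real (card {m<..h}) * (27 / 145 / sqrt (real n))"
  proof (rule mult_right_mono)
    show "2 / 3 * s \<le> real (card {m<..h})" using mh m h s x by (simp add: of_nat_diff)
  qed simp
  also have "\<dots> \<le> (\<Sum>j\<in>{m<..h}. Bernstein n j x)"
  proof (rule sum_bounded_below)
    fix j assume "j \<in> {m<..h}"
    then have "Bernstein n h x \<le> Bernstein n j x"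
      using m by (intro Bernstein_antimono x) auto
    then show "27 / 145 / sqrt (real n) \<le> Bernstein n j x" using \<beta> by simp
  qed
  finally have "3 / 25 * s / sqrt (real n) \<le> (\<Sum>j\<in>{m<..h}. Bernstein n j x)" .
  moreover have "1 / 2 \<le> (\<Sum>j\<le>m. Bernstein n j x)"
    using x m mh h by (intro Bernstein_median) auto
  moreover have "(\<Sum>j\<le>h. Bernstein n j x) = (\<Sum>j\<le>m. Bernstein n j x) + (\<Sum>j\<in>{m<..h}. Bernstein n j x)"
    using mh by (subst sum.union_disjoint[symmetric]) (auto intro!: sum.cong)
  ultimately show ?thesis by linarith
qed

section \<open>Lebesgue measure on coordinate spaces\<close>

lemma prod_Basis_vec:
  fixes f :: "real ^ 'n::finite \<Rightarrow> 'a::comm_monoid_mult"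
  shows "(\<Prod>b\<in>Basis. f b) = (\<Prod>i\<in>UNIV. f (axis i 1))"
proof -
  have B: "(Basis :: (real ^ 'n) set) = range (\<lambda>i. axis i 1)"
    by (auto simp: Basis_vec_def)
  have "inj (\<lambda>i. axis i (1::real) :: real ^ 'n)"
    by (auto simp: inj_on_def axis_eq_axis)
  then show ?thesis unfolding B by (simp add: prod.reindex)
qed

lemma prod_UNIV_option:
  fixes f :: "'d::finite option \<Rightarrow> 'a::comm_monoid_mult"
  shows "(\<Prod>j\<in>UNIV. f j) = f None * (\<Prod>i\<in>UNIV. f (Some i))"
  unfolding UNIV_option_conv by (subst prod.insert) (auto simp: prod.reindex)

lemma sum_UNIV_option:
  fixes f :: "'d::finite option \<Rightarrow> 'a::comm_monoid_add"
  shows "(\<Sum>j\<in>UNIV. f j) = f None + (\<Sum>i\<in>UNIV. f (Some i))"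
  unfolding UNIV_option_conv by (subst sum.insert) (auto simp: sum.reindex)

lemma borel_measurable_vec_nth [measurable]: "(\<lambda>x. x $ i) \<in> borel_measurable (borel :: (real ^ 'n::finite) measure)"
  by (intro borel_measurable_continuous_onI continuous_intros)

text \<open>Links the vector type, on which the densities are stated, with \<open>PiM\<close>, on
  which independence and products of one-dimensional laws are available.\<close>

lemma lborel_vec:
  "(lborel :: (real ^ 'n::finite) measure) = distr (PiM UNIV (\<lambda>_. lborel)) borel (\<lambda>f. \<chi> i. f i)"
proof (rule lborel_eqI)
  fix l u :: "real ^ 'n"
  assume le: "\<And>b. b \<in> Basis \<Longrightarrow> l \<bullet> b \<le> u \<bullet> b"
  have le': "l $ i \<le> u $ i" for i
    using le[of "axis i 1"] by (auto simp: Basis_vec_def inner_axis)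
  have [measurable]: "(\<lambda>f. \<chi> i. f i) \<in> PiM UNIV (\<lambda>_. lborel) \<rightarrow>\<^sub>M (borel :: (real ^ 'n) measure)"
    by (rule borel_measurable_vec_lambda) simp
  interpret product_sigma_finite "\<lambda>_::'n. lborel :: real measure" ..
  have "(\<lambda>f. \<chi> i. f i) -` box l u \<inter> space (PiM UNIV (\<lambda>_. lborel)) = Pi\<^sub>E UNIV (\<lambda>i. {l $ i<..<u $ i})"
    by (auto simp: box_def Basis_vec_def inner_axis space_PiM PiE_iff)
  then have "emeasure (distr (PiM UNIV (\<lambda>_. lborel)) borel (\<lambda>f. \<chi> i. f i)) (box l u)
      = (\<Prod>i\<in>UNIV. ennreal (u $ i - l $ i))"
    by (simp add: emeasure_distr emeasure_PiM le')
  then show "emeasure (distr (PiM UNIV (\<lambda>_. lborel)) borel (\<lambda>f. \<chi> i. f i)) (box l u) = (\<Prod>b\<in>Basis. (u - l) \<bullet> b)"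
    using le' by (simp add: prod_Basis_vec inner_axis prod_ennreal)
qed simp

definition cons0 :: "real \<Rightarrow> real ^ 'd \<Rightarrow> real ^ ('d::finite option)" where
  "cons0 t y = (\<chi> j. case j of None \<Rightarrow> t | Some i \<Rightarrow> y $ i)"

lemma cons0_nth [simp]: "cons0 t y $ None = t" "cons0 t y $ Some i = y $ i"
  by (simp_all add: cons0_def)

lemma borel_measurable_cons0 [measurable]:
  "(\<lambda>(t, y). cons0 t y) \<in> borel \<Otimes>\<^sub>M borel \<rightarrow>\<^sub>M borel"
proof (rule borel_measurable_vec_lambda)
  show "(\<lambda>z. (case z of (t, y) \<Rightarrow> cons0 t y) $ j) \<in> borel_measurable (borel \<Otimes>\<^sub>M borel)" for j :: "'a option"
    by (cases j) (simp_all add: case_prod_beta)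
qed

text \<open>Isolates the coordinate \<open>None\<close>, so that it can be exchanged for the sum of
  all coordinates in the change of variables to the simplex.\<close>

lemma lborel_cons0:
  "(lborel :: (real ^ ('d::finite option)) measure) = distr (lborel \<Otimes>\<^sub>M lborel) borel (\<lambda>(t, y). cons0 t y)"
proof (rule lborel_eqI)
  fix l u :: "real ^ ('d option)"
  assume le: "\<And>b. b \<in> Basis \<Longrightarrow> l \<bullet> b \<le> u \<bullet> b"
  have le': "l $ i \<le> u $ i" for i
    using le[of "axis i 1"] by (auto simp: Basis_vec_def inner_axis)
  have "(\<lambda>(t, y). cons0 t y) -` box l u \<inter> space (lborel \<Otimes>\<^sub>M lborel)
      = {l $ None<..<u $ None} \<times> box (drop0 l) (drop0 u)"
    by (auto simp: box_def Basis_vec_def inner_axis space_pair_measure drop0_def split_option_all)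
  then have "emeasure (distr (lborel \<Otimes>\<^sub>M lborel) borel (\<lambda>(t, y). cons0 t y)) (box l u)
      = ennreal (u $ None - l $ None) * (\<Prod>i\<in>UNIV. ennreal (u $ Some i - l $ Some i))"
    using le' by (auto simp: emeasure_distr lborel.emeasure_pair_measure_Times emeasure_lborel_box_eq
        prod_Basis_vec prod_ennreal) (auto simp: Basis_vec_def inner_axis drop0_def)
  then show "emeasure (distr (lborel \<Otimes>\<^sub>M lborel) borel (\<lambda>(t, y). cons0 t y)) (box l u) = (\<Prod>b\<in>Basis. (u - l) \<bullet> b)"
    using le' by (simp add: prod_Basis_vec inner_axis prod_ennreal prod_UNIV_option ennreal_mult prod_nonneg)
qed simp

text \<open>Applied to Erlang factors for the Dirichlet law and to normal factors for the standard
  Gaussian.\<close>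

lemma density_prod_lborel_vec:
  fixes f :: "'n::finite \<Rightarrow> real \<Rightarrow> real"
  assumes [measurable]: "\<And>i. f i \<in> borel_measurable borel"
    and nn: "\<And>i x. 0 \<le> f i x"
    and P: "\<And>i. prob_space (density lborel (f i))"
  shows "density lborel (\<lambda>x. ennreal (\<Prod>i\<in>UNIV. f i (x $ i)))
    = distr (PiM UNIV (\<lambda>i. density lborel (f i))) borel (\<lambda>y. \<chi> i. y i)"
proof -
  have [measurable]: "(\<lambda>f. \<chi> i. f i) \<in> PiM UNIV (\<lambda>_. lborel) \<rightarrow>\<^sub>M (borel :: (real ^ 'n) measure)"
    by (rule borel_measurable_vec_lambda) simp
  interpret L: product_sigma_finite "\<lambda>_::'n. lborel :: real measure" ..
  interpret P: product_prob_space "\<lambda>i. density lborel (f i)" UNIV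
    by (intro product_prob_spaceI P)
  have eq: "density (PiM UNIV (\<lambda>_. lborel)) (\<lambda>y. ennreal (\<Prod>i\<in>UNIV. f i (y i))) = PiM UNIV (\<lambda>i. density lborel (f i))"
  proof (rule P.PiM_eqI)
    show "sets (density (PiM UNIV (\<lambda>_. lborel)) (\<lambda>y. ennreal (\<Prod>i\<in>UNIV. f i (y i)))) = PiM UNIV (\<lambda>i. density lborel (f i))"
      by (simp cong: sets_PiM_cong)
    fix A :: "'n \<Rightarrow> real set" assume "\<And>i. i \<in> UNIV \<Longrightarrow> A i \<in> sets (density lborel (f i))"
    then have [measurable]: "A i \<in> sets borel" for i by simp
    have A: "Pi\<^sub>E UNIV A \<in> sets (PiM UNIV (\<lambda>_::'n. lborel :: real measure))"
      by (intro sets_PiM_I_finite) auto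
    have "emeasure (density (PiM UNIV (\<lambda>_. lborel)) (\<lambda>y. ennreal (\<Prod>i\<in>UNIV. f i (y i)))) (Pi\<^sub>E UNIV A)
        = (\<integral>\<^sup>+y. (\<Prod>i\<in>UNIV. ennreal (f i (y i)) * indicator (A i) (y i)) \<partial>PiM UNIV (\<lambda>_. lborel))"
      using A by (subst emeasure_density)
        (auto intro!: nn_integral_cong simp: prod.distrib nn prod_ennreal indicator_def PiE_iff)
    also have "\<dots> = (\<Prod>i\<in>UNIV. emeasure (density lborel (f i)) (A i))"
      by (subst L.product_nn_integral_prod) (auto simp: emeasure_density)
    finally show "emeasure (density (PiM UNIV (\<lambda>_. lborel)) (\<lambda>y. ennreal (\<Prod>i\<in>UNIV. f i (y i)))) (Pi\<^sub>E UNIV A)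
        = (\<Prod>i\<in>UNIV. emeasure (density lborel (f i)) (A i))" .
  qed simp
  have "density lborel (\<lambda>x. ennreal (\<Prod>i\<in>UNIV. f i (x $ i)))
      = distr (density (PiM UNIV (\<lambda>_. lborel)) (\<lambda>y. ennreal (\<Prod>i\<in>UNIV. f i (y i)))) borel (\<lambda>y. \<chi> i. y i)"
    by (subst lborel_vec, subst density_distr) simp_all
  then show ?thesis unfolding eq .
qed

lemma indep_vars_PiM_coordinates:
  fixes M :: "'i::finite \<Rightarrow> 'a measure"
  assumes "\<And>i. prob_space (M i)"
  shows "prob_space.indep_vars (PiM UNIV M) M (\<lambda>i y. y i) UNIV"
proof -
  interpret prob_space "PiM UNIV M" by (intro prob_space_PiM assms)
  have "distr (PiM UNIV M) (PiM UNIV M) (\<lambda>y. restrict y UNIV) = PiM UNIV M"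
    by (simp add: restrict_UNIV)
  then show ?thesis
    by (subst indep_vars_iff_distr_eq_PiM) (auto simp: distr_PiM_component assms cong: PiM_cong)
qed

section \<open>The Dirichlet law of a half-space\<close>

text \<open>Brings the density into the shape of a product of Erlang densities. The test
  \<open>< 0\<close> copies the one in \<open>erlang_density\<close>; at 0 the factor vanishes as
  well because the exponent \<open>N j\<close> is positive, in agreement with the zero boundary
  value of \<open>dirichlet_density\<close>.\<close>

lemma dirichlet_density_nat:
  fixes N :: "'d::finite option \<Rightarrow> nat"
  assumes "\<And>j. 0 < N j"
  shows "dirichlet_density (\<chi> j. real (N j) + 1) x = fact ((\<Sum>j\<in>UNIV. N j) + CARD('d)) *
    (\<Prod>j\<in>UNIV. if simplex_point x $ j < 0 then 0 else simplex_point x $ j ^ N j / fact (N j))"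
proof (cases "\<forall>j. 0 < simplex_point x $ j")
  case True
  have "(\<Sum>j\<in>UNIV. real (N j) + 1) = 1 + real ((\<Sum>j\<in>UNIV. N j) + CARD('d))"
    by (simp add: sum.distrib)
  then have "Gamma (\<Sum>j\<in>UNIV. real (N j) + 1) = fact ((\<Sum>j\<in>UNIV. N j) + CARD('d))"
    by (simp only: Gamma_fact)
  moreover have "Gamma (real (N j) + 1) = fact (N j)" for j
    using Gamma_fact[of "N j", where 'a = real] by (simp add: add.commute)
  moreover have "simplex_point x $ j powr real (N j) = simplex_point x $ j ^ N j" for j
    using True by (intro powr_realpow) auto
  moreover have "(if simplex_point x $ j < 0 then 0 else simplex_point x $ j ^ N j / fact (N j))
      = simplex_point x $ j ^ N j / fact (N j)" for j
    using True by (auto simp: not_less less_imp_le)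
  ultimately show ?thesis
    using True by (simp add: dirichlet_density_def prod_dividef)
next
  case False
  then obtain j where j: "simplex_point x $ j \<le> 0" by (auto simp: not_less)
  then have "(if simplex_point x $ j < 0 then 0 else simplex_point x $ j ^ N j / fact (N j)) = 0"
    using assms[of j] by auto
  then have "(\<Prod>j\<in>UNIV. if simplex_point x $ j < 0 then 0 else simplex_point x $ j ^ N j / fact (N j)) = 0"
    by (intro prod_zero bexI[of _ j]) (simp_all only: finite UNIV_I)
  then show ?thesis using False by (simp only: dirichlet_density_def if_False mult_zero_right)
qed

lemma erlang_density_mult:
  assumes "0 < t"
  shows "erlang_density k 1 (t * z) = t ^ k * exp (- t * z) * (if z < 0 then 0 else z ^ k / fact k)"
  using assms by (simp add: erlang_density_def mult_less_0_iff power_mult_distrib)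

lemma sum_simplex_point: "(\<Sum>j\<in>UNIV. simplex_point x $ j) = 1"
  by (simp add: sum_UNIV_option simplex_point_def)

text \<open>The change of variables y = t \<theta>, where t is the coordinate sum and \<theta> lies
  on the hyperplane of sum 1. Replacing the coordinate \<open>None\<close> by t is a translation;
  scaling the d remaining coordinates by t gives the Jacobian t^d. Negative t contribute nothing by
  \<open>neg\<close>, and t = 0 is a null set.\<close>

lemma nn_integral_lborel_cons0:
  fixes g :: "real ^ ('d::finite option) \<Rightarrow> ennreal"
  assumes [measurable]: "g \<in> borel_measurable borel"
    and neg: "\<And>y. (\<Sum>j\<in>UNIV. y $ j) < 0 \<Longrightarrow> g y = 0"
  shows "(\<integral>\<^sup>+y. g y \<partial>lborel)
    = (\<integral>\<^sup>+t. ennreal (t ^ CARD('d)) * indicator {0..} t * (\<integral>\<^sup>+x. g (t *\<^sub>R simplex_point x) \<partial>lborel) \<partial>lborel)"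
proof -
  have "(\<integral>\<^sup>+y. g y \<partial>lborel) = (\<integral>\<^sup>+z. g (cons0 (fst z) (snd z)) \<partial>(lborel \<Otimes>\<^sub>M lborel))"
    by (subst lborel_cons0, subst nn_integral_distr) (simp_all add: case_prod_beta)
  also have "\<dots> = (\<integral>\<^sup>+y. (\<integral>\<^sup>+t. g (cons0 t y) \<partial>lborel) \<partial>lborel)"
    by (subst lborel_pair.nn_integral_snd[symmetric]) (simp_all add: case_prod_beta)
  also have "\<dots> = (\<integral>\<^sup>+y. (\<integral>\<^sup>+t. g (cons0 (t - (\<Sum>i\<in>UNIV. y $ i)) y) \<partial>lborel) \<partial>lborel)"
  proof (rule nn_integral_cong)
    fix y :: "real ^ 'd"
    show "(\<integral>\<^sup>+t. g (cons0 t y) \<partial>lborel) = (\<integral>\<^sup>+t. g (cons0 (t - (\<Sum>i\<in>UNIV. y $ i)) y) \<partial>lborel)"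
      using nn_integral_real_affine[of "\<lambda>t. g (cons0 t y)" 1 "- (\<Sum>i\<in>UNIV. y $ i)"] by simp
  qed
  also have "\<dots> = (\<integral>\<^sup>+t. (\<integral>\<^sup>+y. g (cons0 (t - (\<Sum>i\<in>UNIV. y $ i)) y) \<partial>lborel) \<partial>lborel)"
    by (rule lborel_pair.Fubini') (simp add: case_prod_beta)
  also have "\<dots> = (\<integral>\<^sup>+t. ennreal (t ^ CARD('d)) * indicator {0..} t * (\<integral>\<^sup>+x. g (t *\<^sub>R simplex_point x) \<partial>lborel) \<partial>lborel)"
  proof (rule nn_integral_cong_AE)
    have "AE t in lborel. t \<noteq> (0::real)" by (rule AE_lborel_singleton)
    then show "AE t in lborel. (\<integral>\<^sup>+y. g (cons0 (t - (\<Sum>i\<in>UNIV. y $ i)) y) \<partial>lborel)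
      = ennreal (t ^ CARD('d)) * indicator {0..} t * (\<integral>\<^sup>+x. g (t *\<^sub>R simplex_point x) \<partial>lborel)"
    proof eventually_elim
      fix t :: real assume "t \<noteq> 0"
      then consider "t < 0" | "0 < t" by linarith
      then show "(\<integral>\<^sup>+y. g (cons0 (t - (\<Sum>i\<in>UNIV. y $ i)) y) \<partial>lborel)
        = ennreal (t ^ CARD('d)) * indicator {0..} t * (\<integral>\<^sup>+x. g (t *\<^sub>R simplex_point x) \<partial>lborel)"
      proof cases
        case 1
        then have "g (cons0 (t - (\<Sum>i\<in>UNIV. y $ i)) y) = 0" for y
          by (intro neg) (simp add: sum_UNIV_option)
        then show ?thesis using 1 by simp
      next
        case 2
        have c: "cons0 (t - (\<Sum>i\<in>UNIV. t * x $ i)) (t *\<^sub>R x) = t *\<^sub>R simplex_point x" for x :: "real ^ 'd"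
          by (simp add: vec_eq_iff split_option_all simplex_point_def right_diff_distrib sum_distrib_left)
        have "(\<integral>\<^sup>+y. g (cons0 (t - (\<Sum>i\<in>UNIV. y $ i)) y) \<partial>lborel)
          = (\<integral>\<^sup>+y. g (cons0 (t - (\<Sum>i\<in>UNIV. y $ i)) y)
              \<partial>density (distr lborel borel (\<lambda>x. 0 + t *\<^sub>R x)) (\<lambda>_. \<bar>t\<bar> ^ DIM(real ^ 'd)))"
          using lborel_affine[of t "0 :: real ^ 'd"] 2 by simp
        also have "\<dots> = ennreal (t ^ CARD('d)) * (\<integral>\<^sup>+x. g (t *\<^sub>R simplex_point x) \<partial>lborel)"
          using 2 by (simp add: nn_integral_density nn_integral_distr nn_integral_cmult c)
        finally show ?thesis using 2 by simp
      qed
    qed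
  qed
  finally show ?thesis .
qed

text \<open>A Dirichlet vector with integer parameters is a vector of independent Erlang variables divided
  by its sum, so both give the same mass to a cone.\<close>

lemma emeasure_dirichlet_cone:
  fixes N :: "'d::finite option \<Rightarrow> nat" and H :: "(real ^ ('d option)) set"
  assumes N: "\<And>j. 0 < N j" and H[measurable]: "H \<in> sets borel"
    and cone: "\<And>t y. 0 < t \<Longrightarrow> t *\<^sub>R y \<in> H \<longleftrightarrow> y \<in> H"
  shows "emeasure (density lborel (\<lambda>x. ennreal (dirichlet_density (\<chi> j. real (N j) + 1) x))) (simplex_point -` H)
    = emeasure (density lborel (\<lambda>y. ennreal (\<Prod>j\<in>UNIV. erlang_density (N j) 1 (y $ j)))) H"
proof -
  define n where "n = (\<Sum>j\<in>UNIV. N j)"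
  define W where "W z = (\<Prod>j\<in>UNIV. if z $ j < 0 then 0 else z $ j ^ N j / fact (N j))" for z :: "real ^ ('d option)"
  have W0: "0 \<le> W z" for z unfolding W_def by (intro prod_nonneg) auto
  have [measurable]: "W \<in> borel_measurable borel" unfolding W_def[abs_def] by measurable
  have [measurable]: "simplex_point -` H \<in> sets (borel :: (real ^ 'd) measure)"
    using measurable_sets[OF borel_measurable_simplex_point H] by simp
  define g where "g y = ennreal (\<Prod>j\<in>UNIV. erlang_density (N j) 1 (y $ j)) * indicator H y" for y
  have [measurable]: "g \<in> borel_measurable borel" unfolding g_def[abs_def] by measurable
  \<comment> \<open>As the coordinates of \<theta> sum to 1, the exponentials multiply to exp (- t),
    so the integrand splits into a function of t and a function of \<theta>. The cone property
    removes t from the indicator.\<close>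
  have gt: "g (t *\<^sub>R simplex_point x) = ennreal (t ^ n * exp (- t)) * (ennreal (W (simplex_point x)) * indicator H (simplex_point x))"
    if "0 < t" for t x
  proof -
    let ?\<theta> = "simplex_point x :: real ^ ('d option)"
    have "(\<Prod>j\<in>UNIV. erlang_density (N j) 1 (t * ?\<theta> $ j))
        = (\<Prod>j\<in>UNIV. t ^ N j) * (\<Prod>j\<in>UNIV. exp (- t * ?\<theta> $ j)) * W ?\<theta>"
      unfolding W_def prod.distrib[symmetric] by (rule prod.cong) (auto simp: erlang_density_mult that)
    also have "(\<Prod>j\<in>UNIV. exp (- t * ?\<theta> $ j)) = exp (- t)"
      by (simp add: exp_sum[symmetric] sum_negf sum_distrib_left[symmetric] sum_simplex_point)
    also have "(\<Prod>j\<in>UNIV. t ^ N j) = t ^ n"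
      by (simp add: n_def power_sum)
    finally show ?thesis
      using that W0 by (simp add: g_def cone ennreal_mult indicator_def)
  qed
  have "emeasure (density lborel (\<lambda>y. ennreal (\<Prod>j\<in>UNIV. erlang_density (N j) 1 (y $ j)))) H = (\<integral>\<^sup>+y. g y \<partial>lborel)"
    by (simp add: emeasure_density g_def)
  also have "\<dots> = (\<integral>\<^sup>+t. ennreal (t ^ CARD('d)) * indicator {0..} t * (\<integral>\<^sup>+x. g (t *\<^sub>R simplex_point x) \<partial>lborel) \<partial>lborel)"
  proof (rule nn_integral_lborel_cons0)
    fix y :: "real ^ ('d option)" assume "(\<Sum>j\<in>UNIV. y $ j) < 0"
    then obtain j where "y $ j < 0" by (meson not_less sum_nonneg)
    then have "(\<Prod>j\<in>UNIV. erlang_density (N j) 1 (y $ j)) = 0"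
      by (intro prod_zero) (auto simp: erlang_density_def)
    then show "g y = 0" by (simp only: g_def ennreal_0 mult_zero_left)
  qed simp
  also have "\<dots> = (\<integral>\<^sup>+t. (ennreal (t ^ (n + CARD('d)) * exp (- t)) * indicator {0..} t) *
      (\<integral>\<^sup>+x. ennreal (W (simplex_point x)) * indicator H (simplex_point x) \<partial>lborel) \<partial>lborel)"
  proof (rule nn_integral_cong_AE)
    have "AE t in lborel. t \<noteq> (0::real)" by (rule AE_lborel_singleton)
    then show "AE t in lborel. ennreal (t ^ CARD('d)) * indicator {0..} t * (\<integral>\<^sup>+x. g (t *\<^sub>R simplex_point x) \<partial>lborel)
      = (ennreal (t ^ (n + CARD('d)) * exp (- t)) * indicator {0..} t) *
      (\<integral>\<^sup>+x. ennreal (W (simplex_point x)) * indicator H (simplex_point x) \<partial>lborel)"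
    proof eventually_elim
      fix t :: real assume "t \<noteq> 0"
      show "ennreal (t ^ CARD('d)) * indicator {0..} t * (\<integral>\<^sup>+x. g (t *\<^sub>R simplex_point x) \<partial>lborel)
      = (ennreal (t ^ (n + CARD('d)) * exp (- t)) * indicator {0..} t) *
      (\<integral>\<^sup>+x. ennreal (W (simplex_point x)) * indicator H (simplex_point x) \<partial>lborel)"
      proof (cases "0 < t")
        case True
        then show ?thesis
          by (simp add: gt nn_integral_cmult power_add ennreal_mult mult.assoc) (simp add: mult_ac)
      qed (use \<open>t \<noteq> 0\<close> in simp)
    qed
  qed
  \<comment> \<open>The integral over t is the Gamma integral of t^(n + d) exp (- t), which is the
    normalising factor of the Dirichlet density.\<close>
  also have "\<dots> = ennreal (fact (n + CARD('d))) * (\<integral>\<^sup>+x. ennreal (W (simplex_point x)) * indicator H (simplex_point x) \<partial>lborel)"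
    by (subst nn_integral_multc) (simp_all add: nn_intergal_power_times_exp_Ici)
  also have "\<dots> = emeasure (density lborel (\<lambda>x. ennreal (dirichlet_density (\<chi> j. real (N j) + 1) x))) (simplex_point -` H)"
    using W0 by (subst emeasure_density)
      (auto simp: dirichlet_density_nat N n_def W_def[symmetric] ennreal_mult nn_integral_cmult[symmetric] mult.assoc
        indicator_def vimage_def intro!: nn_integral_cong)
  finally show ?thesis by simp
qed

section \<open>Beta tails as binomial sums\<close>

lemma Bernstein_Suc_Suc: "Bernstein (Suc n) (Suc i) c = c * Bernstein n i c + (1 - c) * Bernstein n (Suc i) c"
proof (cases "i < n")
  case True
  then have e: "(1 - c) ^ (n - i) = (1 - c) * (1 - c) ^ (n - Suc i)"
    by (metis Suc_diff_Suc power_Suc)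
  show ?thesis by (simp add: Bernstein_def e algebra_simps)
qed (auto simp: Bernstein_def binomial_eq_0)

text \<open>Both sides are the probability that at least \<open>l + 1\<close> failures occur in \<open>k + l + 1\<close> trials.\<close>

lemma sum_negative_binomial:
  "(\<Sum>i\<le>k. real (l + i choose i) * c ^ i * (1 - c) ^ Suc l) = (\<Sum>i\<le>k. Bernstein (k + l + 1) i c)"
proof (induction k)
  case (Suc k)
  define n where "n = k + l + 1"
  \<comment> \<open>At most k + 1 successes in n + 1 trials means at most k successes in n of them,
    or exactly k + 1 successes there followed by a failure. The latter probability is the new
    summand on the left.\<close>
  have "(\<Sum>i\<le>Suc k. Bernstein (Suc n) i c) = Bernstein (Suc n) 0 c + (\<Sum>i\<le>k. Bernstein (Suc n) (Suc i) c)"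
    by (rule sum.atMost_Suc_shift)
  also have "\<dots> = (1 - c) * Bernstein n 0 c + c * (\<Sum>i\<le>k. Bernstein n i c) + (1 - c) * (\<Sum>i\<le>k. Bernstein n (Suc i) c)"
  proof -
    have "Bernstein (Suc n) 0 c = (1 - c) * Bernstein n 0 c" by (simp add: Bernstein_def)
    then show ?thesis by (simp add: Bernstein_Suc_Suc sum.distrib sum_distrib_left)
  qed
  also have "\<dots> = c * (\<Sum>i\<le>k. Bernstein n i c) + (1 - c) * (Bernstein n 0 c + (\<Sum>i\<le>k. Bernstein n (Suc i) c))"
    by (simp add: algebra_simps)
  also have "Bernstein n 0 c + (\<Sum>i\<le>k. Bernstein n (Suc i) c) = (\<Sum>i\<le>k. Bernstein n i c) + Bernstein n (Suc k) c"
    by (subst sum.atMost_Suc_shift[symmetric]) simp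
  also have "c * (\<Sum>i\<le>k. Bernstein n i c) + (1 - c) * ((\<Sum>i\<le>k. Bernstein n i c) + Bernstein n (Suc k) c)
      = (\<Sum>i\<le>k. Bernstein n i c) + (1 - c) * Bernstein n (Suc k) c"
    by (simp add: algebra_simps)
  also have "(1 - c) * Bernstein n (Suc k) c = real (l + Suc k choose Suc k) * c ^ Suc k * (1 - c) ^ Suc l"
  proof -
    have "n = l + Suc k" "n - Suc k = l" by (simp_all add: n_def)
    then show ?thesis by (simp add: Bernstein_def mult_ac)
  qed
  finally show ?case using Suc by (simp add: n_def)
qed (simp add: Bernstein_def)

text \<open>The right-hand side is the probability that a Poisson process of rate 1 has at most k
  points up to time t.\<close>

lemma nn_integral_erlang_greaterThan:
  assumes "0 \<le> t"
  shows "(\<integral>\<^sup>+u. ennreal (erlang_density k 1 u) * indicator {t<..} u \<partial>lborel)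
    = ennreal (\<Sum>i\<le>k. t ^ i * exp (- t) / fact i)"
proof -
  let ?D = "density lborel (\<lambda>u. ennreal (erlang_density k 1 u))"
  interpret D: prob_space ?D by (rule prob_space_erlang_density) simp
  have "emeasure ?D {..t} = erlang_CDF k 1 t" by (rule emeasure_erlang_density) simp
  then have m: "measure ?D {..t} = 1 - (\<Sum>i\<le>k. t ^ i * exp (- t) / fact i)"
    using assms erlang_CDF_nonneg[of 1 k t] by (simp add: measure_def erlang_CDF_def)
  have "(\<integral>\<^sup>+u. ennreal (erlang_density k 1 u) * indicator {t<..} u \<partial>lborel) = emeasure ?D (space ?D - {..t})"
    by (subst emeasure_density) (auto intro!: nn_integral_cong simp: indicator_def)
  also have "\<dots> = ennreal (\<Sum>i\<le>k. t ^ i * exp (- t) / fact i)"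
    by (subst D.emeasure_eq_measure, subst D.prob_compl) (simp_all add: m)
  finally show ?thesis .
qed

text \<open>Conditionally on V = v the event is U > r v with r = c / (1 - c), whose probability is a
  Poisson sum. Each of its terms, multiplied by the density of V, is again an Erlang density, of
  rate 1 + r, times a constant. Integrating out v leaves these constants, which are the negative
  binomial probabilities \<open>q i\<close>.\<close>

lemma (in prob_space) emeasure_erlang_proportion:
  assumes indep: "indep_var borel U borel V"
    and U: "distributed M lborel U (erlang_density k 1)"
    and V: "distributed M lborel V (erlang_density l 1)"
    and c: "0 < c" "c < 1"
  shows "emeasure M {\<omega> \<in> space M. c * (U \<omega> + V \<omega>) < U \<omega>} = ennreal (\<Sum>i\<le>k. Bernstein (k + l + 1) i c)"
proof -
  define r where "r = c / (1 - c)"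
  have r: "0 < r" "1 + r = 1 / (1 - c)" using c by (simp_all add: r_def field_simps)
  have iff: "c * (u + v) < u \<longleftrightarrow> r * v < u" for u v
    using c by (simp add: r_def field_simps)
  have [measurable]: "U \<in> borel_measurable M" "V \<in> borel_measurable M"
    using distributed_measurable[OF U] distributed_measurable[OF V] by simp_all
  have indep': "indep_var lborel U lborel V"
    using indep unfolding indep_var_eq by simp
  have J: "distributed M (lborel \<Otimes>\<^sub>M lborel) (\<lambda>\<omega>. (U \<omega>, V \<omega>)) (\<lambda>(u, v). ennreal (erlang_density k 1 u) * ennreal (erlang_density l 1 v))"
    by (rule distributed_joint_indep[OF _ _ U V indep']) (rule lborel.sigma_finite_measure_axioms)+
  define q where "q i = real (l + i choose i) * c ^ i * (1 - c) ^ Suc l" for i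
  have q0: "0 \<le> q i" for i using c by (simp add: q_def)
  have inner: "ennreal (erlang_density l 1 v) * ennreal (\<Sum>i\<le>k. (r * v) ^ i * exp (- (r * v)) / fact i)
      = (\<Sum>i\<le>k. ennreal (q i) * ennreal (erlang_density (l + i) (1 + r) v))" if v: "0 \<le> v" for v
  proof -
    have e: "erlang_density l 1 v * ((r * v) ^ i * exp (- (r * v)) / fact i) = q i * erlang_density (l + i) (1 + r) v" for i
    proof -
      have "r = c * (1 + r)" unfolding r(2) by (simp add: r_def)
      then have "r ^ i = c ^ i * (1 + r) ^ i" by (metis power_mult_distrib)
      moreover have "(1 - c) ^ Suc l * (1 + r) ^ Suc l = 1"
        unfolding power_mult_distrib[symmetric] r(2) using c by simp
      moreover have "real (l + i choose i) = fact (l + i) / (fact i * fact l)"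
        by (subst binomial_fact) simp_all
      moreover have "exp (- v) * exp (- (r * v)) = exp (- (1 + r) * v)"
        by (simp add: exp_add[symmetric] algebra_simps)
      ultimately have "q i * erlang_density (l + i) (1 + r) v
          = ((1 - c) ^ Suc l * (1 + r) ^ Suc l) * (r ^ i * v ^ i * v ^ l * (exp (- v) * exp (- (r * v))) / (fact i * fact l))"
        using v by (simp add: q_def erlang_density_def power_add mult_ac)
      also have "\<dots> = erlang_density l 1 v * ((r * v) ^ i * exp (- (r * v)) / fact i)"
        using v \<open>(1 - c) ^ Suc l * (1 + r) ^ Suc l = 1\<close>
        by (simp only: erlang_density_def) (simp add: power_mult_distrib mult_ac)
      finally show ?thesis ..
    qed
    have "erlang_density l 1 v * (\<Sum>i\<le>k. (r * v) ^ i * exp (- (r * v)) / fact i)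
        = (\<Sum>i\<le>k. q i * erlang_density (l + i) (1 + r) v)"
      unfolding sum_distrib_left by (rule sum.cong[OF refl e])
    moreover have "0 \<le> (\<Sum>i\<le>k. (r * v) ^ i * exp (- (r * v)) / fact i)"
      using r v by (intro sum_nonneg) auto
    ultimately have "ennreal (erlang_density l 1 v) * ennreal (\<Sum>i\<le>k. (r * v) ^ i * exp (- (r * v)) / fact i)
        = ennreal (\<Sum>i\<le>k. q i * erlang_density (l + i) (1 + r) v)"
      by (subst ennreal_mult[symmetric]) simp_all
    also have "\<dots> = (\<Sum>i\<le>k. ennreal (q i) * ennreal (erlang_density (l + i) (1 + r) v))"
      using q0 r(1) by (subst sum_ennreal[symmetric]) (simp_all add: ennreal_mult)
    finally show ?thesis .
  qed
  have "emeasure M {\<omega> \<in> space M. c * (U \<omega> + V \<omega>) < U \<omega>}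
      = emeasure M ((\<lambda>\<omega>. (U \<omega>, V \<omega>)) -` {z. r * snd z < fst z} \<inter> space M)"
    by (rule arg_cong2[where f = emeasure]) (auto simp: iff)
  also have "\<dots> = (\<integral>\<^sup>+z. (case z of (u, v) \<Rightarrow> ennreal (erlang_density k 1 u) * ennreal (erlang_density l 1 v))
      * indicator {z. r * snd z < fst z} z \<partial>(lborel \<Otimes>\<^sub>M lborel))"
  proof (rule distributed_emeasure[OF J])
    have "{z \<in> space (lborel \<Otimes>\<^sub>M lborel). r * snd z < fst z} \<in> sets (lborel \<Otimes>\<^sub>M (lborel :: real measure))"
      by measurable
    then show "{z. r * snd z < fst z} \<in> sets (lborel \<Otimes>\<^sub>M (lborel :: real measure))"
      by (simp add: space_pair_measure)
  qed
  also have "\<dots> = (\<integral>\<^sup>+v. (\<integral>\<^sup>+u. ennreal (erlang_density l 1 v) * (ennreal (erlang_density k 1 u) * indicator {r * v<..} u) \<partial>lborel) \<partial>lborel)"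
    by (subst lborel_pair.nn_integral_snd[symmetric])
      (auto intro!: nn_integral_cong simp: indicator_def case_prod_beta mult.commute)
  also have "\<dots> = (\<integral>\<^sup>+v. (\<Sum>i\<le>k. ennreal (q i) * ennreal (erlang_density (l + i) (1 + r) v)) \<partial>lborel)"
  proof (rule nn_integral_cong)
    fix v :: real
    show "(\<integral>\<^sup>+u. ennreal (erlang_density l 1 v) * (ennreal (erlang_density k 1 u) * indicator {r * v<..} u) \<partial>lborel)
      = (\<Sum>i\<le>k. ennreal (q i) * ennreal (erlang_density (l + i) (1 + r) v))"
    proof (cases "v < 0")
      case True
      then show ?thesis by (simp add: erlang_density_def)
    next
      case False
      then show ?thesis
        using r by (subst nn_integral_cmult) (simp_all add: nn_integral_erlang_greaterThan inner)
    qed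
  qed
  also have "\<dots> = (\<Sum>i\<le>k. ennreal (q i) * (\<integral>\<^sup>+v. ennreal (erlang_density (l + i) (1 + r) v) \<partial>lborel))"
    by (subst nn_integral_sum) (simp_all add: nn_integral_cmult)
  also have "\<dots> = (\<Sum>i\<le>k. ennreal (q i))"
  proof (rule sum.cong)
    fix i
    show "ennreal (q i) * (\<integral>\<^sup>+v. ennreal (erlang_density (l + i) (1 + r) v) \<partial>lborel) = ennreal (q i)"
      using nn_integral_erlang_ith_moment[of "1 + r" "l + i" 0] r(1) by simp
  qed simp
  also have "\<dots> = ennreal (\<Sum>i\<le>k. q i)"
    using q0 by (simp add: sum_ennreal)
  finally show ?thesis
    unfolding q_def sum_negative_binomial .
qed

text \<open>The sums over A and over its complement are independent Erlang variables; both sets are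
  nonempty, so both sums have densities. Since \<open>erlang_density k\<close> has shape k + 1, the
  shapes that add up are \<open>Suc (N j)\<close>, and the index of a sum is one less than the total
  shape.\<close>

lemma emeasure_PiM_erlang_proportion:
  fixes N :: "'i::finite \<Rightarrow> nat"
  assumes A: "A \<noteq> {}" "A \<noteq> UNIV" and c: "0 < c" "c < 1"
  shows "emeasure (PiM UNIV (\<lambda>j. density lborel (\<lambda>u. ennreal (erlang_density (N j) 1 u)))) {y. c * (\<Sum>j\<in>UNIV. y j) < (\<Sum>j\<in>A. y j)}
    = ennreal (\<Sum>i<(\<Sum>j\<in>A. Suc (N j)). Bernstein ((\<Sum>j\<in>UNIV. Suc (N j)) - 1) i c)"
proof -
  define E where "E j = density lborel (\<lambda>u. ennreal (erlang_density (N j) 1 u))" for j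
  have E: "prob_space (E j)" for j unfolding E_def by (rule prob_space_erlang_density) simp
  interpret prob_space "PiM UNIV E" by (intro prob_space_PiM E)
  have "indep_vars E (\<lambda>j y. y j) UNIV" by (rule indep_vars_PiM_coordinates) (rule E)
  then have ind: "indep_vars (\<lambda>_. borel) (\<lambda>j y. y j) UNIV"
    using indep_vars_compose2[of E "\<lambda>j y. y j" UNIV "\<lambda>_ y. y" "\<lambda>_. borel"] by (simp add: E_def)
  have D: "distributed (PiM UNIV E) lborel (\<lambda>y. y j) (erlang_density (N j) 1)" for j
  proof -
    have "distr (PiM UNIV E) lborel (\<lambda>y. y j) = distr (PiM UNIV E) (E j) (\<lambda>y. y j)"
      by (rule distr_cong) (simp_all add: E_def)
    also have "\<dots> = E j" by (rule distr_PiM_component) (simp_all add: E)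
    finally show ?thesis
      using ind unfolding distributed_def indep_vars_def by (simp add: E_def)
  qed
  define S where "S B y = (\<Sum>j\<in>B. y j)" for B and y :: "'i \<Rightarrow> real"
  have DS: "distributed (PiM UNIV E) lborel (S B) (erlang_density ((\<Sum>j\<in>B. Suc (N j)) - 1) 1)" if "B \<noteq> {}" for B
    unfolding S_def[abs_def] by (rule erlang_distributed_sum) (use that D indep_vars_subset[OF ind] in auto)
  have A': "- A \<noteq> {}" using A by auto
  have "indep_var (PiM A (\<lambda>_. borel)) (\<lambda>y. restrict (\<lambda>j. y j) A) (PiM (- A) (\<lambda>_. borel)) (\<lambda>y. restrict (\<lambda>j. y j) (- A))"
    by (rule indep_var_restrict[OF ind]) auto
  then have "indep_var borel (S A \<circ> (\<lambda>y. restrict (\<lambda>j. y j) A)) borel (S (- A) \<circ> (\<lambda>y. restrict (\<lambda>j. y j) (- A)))"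
    by (rule indep_var_compose) (simp_all add: S_def[abs_def])
  then have "indep_var borel (S A) borel (S (- A))"
    by (simp add: S_def[abs_def] comp_def)
  then have "emeasure (PiM UNIV E) {y \<in> space (PiM UNIV E). c * (S A y + S (- A) y) < S A y}
    = ennreal (\<Sum>i\<le>(\<Sum>j\<in>A. Suc (N j)) - 1. Bernstein (((\<Sum>j\<in>A. Suc (N j)) - 1) + ((\<Sum>j\<in>-A. Suc (N j)) - 1) + 1) i c)"
    by (rule emeasure_erlang_proportion[OF _ DS[OF A(1)] DS[OF A'] c])
  moreover have "S A y + S (- A) y = (\<Sum>j\<in>UNIV. y j)" for y
    unfolding S_def by (subst sum.union_disjoint[symmetric]) (auto intro!: sum.cong)
  moreover have "space (PiM UNIV E) = UNIV" by (simp add: space_PiM E_def PiE_UNIV_domain)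
  moreover have "0 < (\<Sum>j\<in>A. Suc (N j))" "0 < (\<Sum>j\<in>-A. Suc (N j))"
    using A by (auto intro!: sum_pos simp del: sum_Suc)
  moreover have "(\<Sum>j\<in>UNIV. Suc (N j)) = (\<Sum>j\<in>A. Suc (N j)) + (\<Sum>j\<in>-A. Suc (N j))"
    by (subst sum.union_disjoint[symmetric]) (auto intro!: sum.cong)
  moreover have "{..(\<Sum>j\<in>A. Suc (N j)) - 1} = {..<(\<Sum>j\<in>A. Suc (N j))}"
    using \<open>0 < (\<Sum>j\<in>A. Suc (N j))\<close> by (metis Suc_pred' lessThan_Suc_atMost)
  moreover have "((\<Sum>j\<in>A. Suc (N j)) - 1) + ((\<Sum>j\<in>-A. Suc (N j)) - 1) + 1 = (\<Sum>j\<in>UNIV. Suc (N j)) - 1"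
    using \<open>0 < (\<Sum>j\<in>A. Suc (N j))\<close> \<open>0 < (\<Sum>j\<in>-A. Suc (N j))\<close>
      \<open>(\<Sum>j\<in>UNIV. Suc (N j)) = (\<Sum>j\<in>A. Suc (N j)) + (\<Sum>j\<in>-A. Suc (N j))\<close>
    by linarith
  moreover have "{y. c * (\<Sum>j\<in>UNIV. y j) < (\<Sum>j\<in>A. y j)} = {y \<in> UNIV. c * (\<Sum>j\<in>UNIV. y j) < S A y}"
    by (simp add: S_def)
  ultimately show ?thesis
    unfolding E_def[symmetric] by simp
qed

text \<open>On the simplex the coordinate sum is 1, so the condition c < \<theta>(A) can be made
  homogeneous and describes a cone, to which the comparison with independent Erlang variables
  applies.\<close>

lemma measure_dirichlet_halfspace:
  fixes N :: "'d::finite option \<Rightarrow> nat"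
  assumes N: "\<And>j. 0 < N j" and A: "A \<noteq> {}" "A \<noteq> UNIV" and c: "0 < c" "c < 1"
  shows "measure (marginal0 (dirichlet (\<chi> j. real (N j) + 1))) {x. c < (\<Sum>j\<in>A. simplex_point x $ j)}
    = (\<Sum>i<(\<Sum>j\<in>A. Suc (N j)). Bernstein ((\<Sum>j\<in>UNIV. N j) + CARD('d)) i c)"
proof -
  define H where "H = {y :: real ^ ('d option). c * (\<Sum>j\<in>UNIV. y $ j) < (\<Sum>j\<in>A. y $ j)}"
  have H[measurable]: "H \<in> sets borel" unfolding H_def by measurable
  have cone: "t *\<^sub>R y \<in> H \<longleftrightarrow> y \<in> H" if "0 < t" for t y
  proof -
    have "t *\<^sub>R y \<in> H \<longleftrightarrow> t * (c * (\<Sum>j\<in>UNIV. y $ j)) < t * (\<Sum>j\<in>A. y $ j)"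
      by (simp add: H_def sum_distrib_left mult_ac)
    then show ?thesis using that by (simp add: H_def)
  qed
  have "{x. c < (\<Sum>j\<in>A. simplex_point x $ j)} = simplex_point -` H"
    by (auto simp: H_def sum_simplex_point)
  then have "emeasure (marginal0 (dirichlet (\<chi> j. real (N j) + 1))) {x. c < (\<Sum>j\<in>A. simplex_point x $ j)}
      = emeasure (density lborel (\<lambda>y. ennreal (\<Prod>j\<in>UNIV. erlang_density (N j) 1 (y $ j)))) H"
    using emeasure_dirichlet_cone[OF N H cone] by (simp add: marginal0_dirichlet)
  also have "density lborel (\<lambda>y. ennreal (\<Prod>j\<in>UNIV. erlang_density (N j) 1 (y $ j)))
      = distr (PiM UNIV (\<lambda>j. density lborel (\<lambda>u. ennreal (erlang_density (N j) 1 u)))) borel (\<lambda>y. \<chi> j. y j)"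
    by (rule density_prod_lborel_vec) (simp_all add: prob_space_erlang_density)
  also have "emeasure \<dots> H = emeasure (PiM UNIV (\<lambda>j. density lborel (\<lambda>u. ennreal (erlang_density (N j) 1 u))))
      {y. c * (\<Sum>j\<in>UNIV. y j) < (\<Sum>j\<in>A. y j)}"
    by (subst emeasure_distr)
      (auto simp: H_def space_PiM PiE_UNIV_domain vimage_def intro!: borel_measurable_vec_lambda)
  also have "\<dots> = ennreal (\<Sum>i<(\<Sum>j\<in>A. Suc (N j)). Bernstein ((\<Sum>j\<in>UNIV. Suc (N j)) - 1) i c)"
    by (rule emeasure_PiM_erlang_proportion) fact+
  also have "(\<Sum>j\<in>UNIV. Suc (N j)) - 1 = (\<Sum>j\<in>UNIV. N j) + CARD('d)"
    by (simp only: sum_Suc) simp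
  finally show ?thesis
    using c by (simp add: measure_def sum_nonneg Bernstein_nonneg)
qed

text \<open>The whole space is a cone too, so the total mass equals that of a product of probability
  measures.\<close>

lemma prob_space_dirichlet:
  fixes N :: "'d::finite option \<Rightarrow> nat"
  assumes N: "\<And>j. 0 < N j"
  shows "prob_space (marginal0 (dirichlet (\<chi> j. real (N j) + 1)))"
proof
  let ?E = "PiM UNIV (\<lambda>j. density lborel (\<lambda>u. ennreal (erlang_density (N j) 1 u)))"
  interpret E: prob_space ?E by (intro prob_space_PiM prob_space_erlang_density) simp
  have "density lborel (\<lambda>y. ennreal (\<Prod>j\<in>UNIV. erlang_density (N j) 1 (y $ j))) = distr ?E borel (\<lambda>y. \<chi> j. y j)"
    by (rule density_prod_lborel_vec) (simp_all add: prob_space_erlang_density)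
  also have "prob_space \<dots>"
    by (intro E.prob_space_distr borel_measurable_vec_lambda) simp
  finally have "emeasure (density lborel (\<lambda>y. ennreal (\<Prod>j\<in>UNIV. erlang_density (N j) 1 (y $ j)))) UNIV = 1"
    using prob_space.emeasure_space_1 by fastforce
  then show "emeasure (marginal0 (dirichlet (\<chi> j. real (N j) + 1))) (space (marginal0 (dirichlet (\<chi> j. real (N j) + 1)))) = 1"
    using emeasure_dirichlet_cone[of N UNIV, OF N] by (simp add: marginal0_dirichlet)
qed

section \<open>Gaussian laws\<close>

lemma nn_integral_lborel_translate:
  fixes c :: "'a::euclidean_space"
  assumes [measurable]: "f \<in> borel_measurable borel"
  shows "(\<integral>\<^sup>+x. f (c + x) \<partial>lborel) = (\<integral>\<^sup>+x. f x \<partial>lborel)"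
proof -
  have "(\<integral>\<^sup>+x. f x \<partial>lborel) = (\<integral>\<^sup>+x. f x \<partial>distr lborel borel ((+) c))"
    by (simp add: lborel_distr_plus)
  also have "\<dots> = (\<integral>\<^sup>+x. f (c + x) \<partial>lborel)"
    by (rule nn_integral_distr) simp_all
  finally show ?thesis ..
qed

text \<open>Uniqueness of Haar measure: integrating \<open>1\<^bsub>B\<^esub>(T x) g(y + T x)\<close> over \<open>x\<close> and \<open>y\<close> in both orders, where \<open>B\<close> is
  the unit ball, shows that Lebesgue measure and its image under \<open>T\<close> are proportional, and
  both give the same mass to \<open>B\<close>.\<close>

lemma distr_lborel_orthogonal_transformation:
  fixes T :: "'a::euclidean_space \<Rightarrow> 'a"
  assumes T: "orthogonal_transformation T"
  shows "distr lborel borel T = lborel"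
proof (rule measure_eqI)
  have lin: "linear T" using T by (rule orthogonal_transformation_linear)
  have T_m[measurable]: "T \<in> borel \<rightarrow>\<^sub>M borel"
    using lin by (intro borel_measurable_continuous_onI linear_continuous_on) (simp add: linear_conv_bounded_linear)
  define B :: "'a set" where "B = ball 0 1"
  have B[measurable]: "B \<in> sets borel" by (simp add: B_def)
  fix A assume "A \<in> sets (distr lborel borel T)"
  then have A[measurable]: "A \<in> sets borel" by simp
  define f :: "'a \<Rightarrow> ennreal" where "f = indicator B"
  define g :: "'a \<Rightarrow> ennreal" where "g = indicator A"
  have [measurable]: "f \<in> borel_measurable borel" "g \<in> borel_measurable borel"
    by (simp_all add: f_def g_def)
  have fT: "f (T x) = f x" for x
    using orthogonal_transformation_norm[OF T] by (simp add: f_def B_def indicator_def)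
  have "f (- z) = f z" for z by (simp add: f_def B_def indicator_def)
  then have f_minus: "f (z - y) = f (y - z)" for y z by (metis minus_diff_eq)
  have "(\<integral>\<^sup>+x. f x \<partial>lborel) * (\<integral>\<^sup>+y. g y \<partial>lborel) = (\<integral>\<^sup>+x. f (T x) * (\<integral>\<^sup>+y. g (T x + y) \<partial>lborel) \<partial>lborel)"
    by (simp add: nn_integral_lborel_translate nn_integral_multc fT)
  also have "\<dots> = (\<integral>\<^sup>+x. (\<integral>\<^sup>+y. f (T x) * g (T x + y) \<partial>lborel) \<partial>lborel)"
    by (simp add: nn_integral_cmult)
  also have "\<dots> = (\<integral>\<^sup>+y. (\<integral>\<^sup>+x. f (T x) * g (T x + y) \<partial>lborel) \<partial>lborel)"
    by (rule lborel_pair.Fubini'[symmetric]) measurable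
  also have "\<dots> = (\<integral>\<^sup>+y. (\<integral>\<^sup>+x. f (T x - y) * g (T x) \<partial>lborel) \<partial>lborel)"
  proof (rule nn_integral_cong)
    fix y
    \<comment> \<open>Writing y as an image under T turns the shift of T x by y into a shift of x by
      z, under which Lebesgue measure is invariant.\<close>
    obtain z where z: "y = T z"
      using orthogonal_transformation_surj[OF T] by (metis surjD)
    show "(\<integral>\<^sup>+x. f (T x) * g (T x + y) \<partial>lborel) = (\<integral>\<^sup>+x. f (T x - y) * g (T x) \<partial>lborel)"
      using nn_integral_lborel_translate[of "\<lambda>x. f (T x - y) * g (T x)" z]
      by (simp add: z linear_add[OF lin] add.commute)
  qed
  also have "\<dots> = (\<integral>\<^sup>+x. (\<integral>\<^sup>+y. f (T x - y) * g (T x) \<partial>lborel) \<partial>lborel)"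
    by (rule lborel_pair.Fubini') measurable
  also have "\<dots> = (\<integral>\<^sup>+x. (\<integral>\<^sup>+y. f (- T x + y) \<partial>lborel) * g (T x) \<partial>lborel)"
    by (simp add: nn_integral_multc f_minus)
  also have "\<dots> = (\<integral>\<^sup>+x. f x \<partial>lborel) * (\<integral>\<^sup>+x. g (T x) \<partial>lborel)"
    using nn_integral_lborel_translate[of f "- T x" for x] by (simp add: nn_integral_cmult)
  finally have eq: "(\<integral>\<^sup>+x. f x \<partial>lborel) * (\<integral>\<^sup>+y. g y \<partial>lborel) = (\<integral>\<^sup>+x. f x \<partial>lborel) * (\<integral>\<^sup>+x. g (T x) \<partial>lborel)" .
  have "emeasure lborel B * emeasure lborel A = emeasure lborel B * emeasure (distr lborel borel T) A"
  proof -
    have "(\<integral>\<^sup>+x. g (T x) \<partial>lborel) = (\<integral>\<^sup>+y. g y \<partial>distr lborel borel T)"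
      by (rule nn_integral_distr[symmetric]) simp_all
    also have "\<dots> = emeasure (distr lborel borel T) A"
      unfolding g_def by (rule nn_integral_indicator) simp
    finally have "(\<integral>\<^sup>+x. g (T x) \<partial>lborel) = emeasure (distr lborel borel T) A" .
    moreover have "(\<integral>\<^sup>+x. f x \<partial>lborel) = emeasure lborel B" "(\<integral>\<^sup>+x. g x \<partial>lborel) = emeasure lborel A"
      by (simp_all add: f_def g_def)
    ultimately show ?thesis
      using eq by simp
  qed
  moreover have "emeasure lborel B \<noteq> 0" "emeasure lborel B \<noteq> \<infinity>"
    using content_ball_pos[of 1 "0::'a"] emeasure_lborel_ball_finite[of "0::'a" 1]
    by (auto simp: B_def measure_def)
  ultimately show "emeasure (distr lborel borel T) A = emeasure lborel A"
    by (simp add: ennreal_mult_cancel_left)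
qed simp

lemma borel_measurable_matrix_vector_mult [measurable]:
  fixes A :: "real ^ 'n::finite ^ 'm::finite"
  shows "(*v) A \<in> borel \<rightarrow>\<^sub>M borel"
  by (intro borel_measurable_continuous_onI linear_continuous_on) (simp add: linear_conv_bounded_linear[symmetric])

lemma prod_std_normal_density:
  "(\<Prod>i\<in>UNIV. std_normal_density ((z :: real ^ 'n::finite) $ i)) = (1 / sqrt (2 * pi)) ^ CARD('n) * exp (- (norm z)\<^sup>2 / 2)"
proof -
  have "(\<Prod>i\<in>UNIV. std_normal_density (z $ i)) = (\<Prod>i\<in>(UNIV :: 'n set). 1 / sqrt (2 * pi)) * (\<Prod>i\<in>UNIV. exp (- (z $ i)\<^sup>2 / 2))"
    unfolding prod.distrib[symmetric] by (rule prod.cong) (simp_all add: std_normal_density_def)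
  also have "(\<Prod>i\<in>UNIV. exp (- (z $ i)\<^sup>2 / 2)) = exp (- (norm z)\<^sup>2 / 2)"
    by (simp add: exp_sum[symmetric] sum_negf sum_divide_distrib[symmetric] power2_norm_eq_inner)
      (simp add: inner_vec_def power2_eq_square)
  finally show ?thesis by simp
qed

lemma sets_std_gaussian [simp, measurable_cong]: "sets std_gaussian = sets borel"
  by (simp add: std_gaussian_def)

lemma space_std_gaussian [simp]: "space std_gaussian = UNIV"
  by (simp add: std_gaussian_def)

lemma std_gaussian_PiM:
  "(std_gaussian :: (real ^ 'n::finite) measure)
    = distr (PiM UNIV (\<lambda>_. density lborel (\<lambda>x. ennreal (std_normal_density x)))) borel (\<lambda>y. \<chi> i. y i)"
  unfolding std_gaussian_def by (rule density_prod_lborel_vec) (simp_all add: prob_space_normal_density)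

lemma prob_space_std_gaussian: "prob_space (std_gaussian :: (real ^ 'n::finite) measure)"
proof -
  interpret prob_space "PiM (UNIV :: 'n set) (\<lambda>_. density lborel (\<lambda>x. ennreal (std_normal_density x)))"
    by (intro prob_space_PiM prob_space_normal_density) simp
  show ?thesis unfolding std_gaussian_PiM by (intro prob_space_distr borel_measurable_vec_lambda) simp
qed

text \<open>Lebesgue measure is invariant under T, and the density depends on the norm only.\<close>

lemma distr_std_gaussian_orthogonal:
  fixes T :: "real ^ 'n::finite \<Rightarrow> real ^ 'n"
  assumes T: "orthogonal_transformation T"
  shows "distr std_gaussian borel T = std_gaussian"
proof -
  let ?f = "\<lambda>z :: real ^ 'n. ennreal (\<Prod>i\<in>UNIV. std_normal_density (z $ i))"
  have [measurable]: "T \<in> borel \<rightarrow>\<^sub>M borel"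
    using orthogonal_transformation_linear[OF T]
    by (intro borel_measurable_continuous_onI linear_continuous_on) (simp add: linear_conv_bounded_linear)
  have f: "?f (T z) = ?f z" for z
    by (simp add: prod_std_normal_density orthogonal_transformation_norm[OF T])
  have "std_gaussian = density (distr lborel borel T) ?f"
    by (simp add: distr_lborel_orthogonal_transformation[OF T] std_gaussian_def)
  also have "\<dots> = distr (density lborel (\<lambda>z. ?f (T z))) borel T"
    by (rule density_distr) simp_all
  finally show ?thesis unfolding f by (simp add: std_gaussian_def)
qed

section \<open>Gaussian marginals, and the dependence of a Gaussian law on its covariance\<close>

lemma distr_std_gaussian_drop0:
  "distr std_gaussian borel drop0 = (std_gaussian :: (real ^ 'd::finite) measure)"
proof -
  define G where "G = density lborel (\<lambda>x. ennreal (std_normal_density x))"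
  have G: "prob_space G" unfolding G_def by (rule prob_space_normal_density) simp
  have [simp, measurable_cong]: "sets G = sets borel" by (simp add: G_def)
  have [measurable]: "(\<lambda>y. \<chi> i. y i) \<in> PiM UNIV (\<lambda>_. G) \<rightarrow>\<^sub>M (borel :: (real ^ 'n::finite) measure)"
    by (rule borel_measurable_vec_lambda) simp
  have [measurable]: "(\<lambda>y i. y (Some i)) \<in> PiM UNIV (\<lambda>_. G) \<rightarrow>\<^sub>M PiM (UNIV :: 'd set) (\<lambda>_. G)"
    by (rule measurable_PiM_single') (auto simp: space_PiM G_def)
  have "distr (PiM UNIV (\<lambda>_. G)) (PiM (UNIV :: 'd set) (\<lambda>_. G)) (\<lambda>y i. y (Some i)) = PiM UNIV (\<lambda>_. G)"
    using distr_PiM_reindex[of UNIV "\<lambda>_. G" Some "UNIV :: 'd set"] G by (simp add: restrict_UNIV)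
  then have "distr (distr (PiM UNIV (\<lambda>_. G)) (PiM (UNIV :: 'd set) (\<lambda>_. G)) (\<lambda>y i. y (Some i))) borel (\<lambda>y. \<chi> i. y i)
      = std_gaussian"
    by (simp add: std_gaussian_PiM G_def)
  moreover have "distr (PiM UNIV (\<lambda>_. G)) borel (\<lambda>y. (\<chi> i. y i :: real ^ ('d option))) = std_gaussian"
    by (simp add: std_gaussian_PiM G_def)
  ultimately show ?thesis
    by (subst (asm) distr_distr, simp, simp)
       (auto simp: distr_distr comp_def drop0_def simp flip: \<open>distr (PiM UNIV (\<lambda>_. G)) borel (\<lambda>y. (\<chi> i. y i :: real ^ ('d option))) = std_gaussian\<close>)
qed

text \<open>A linear map from d + 1 to d dimensions has a nonzero kernel vector. It is orthogonal to
  all rows of Q, so after normalisation it supplies the missing row.\<close>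

lemma orthonormal_rows_extend:
  fixes Q :: "real ^ ('d::finite option) ^ 'd"
  assumes Q: "Q ** transpose Q = mat 1"
  obtains M :: "real ^ ('d option) ^ ('d option)" where "orthogonal_matrix M" "\<And>i. M $ Some i = Q $ i"
proof -
  have "\<not> inj ((*v) Q)"
  proof
    assume "inj ((*v) Q)"
    then have "dim ((*v) Q ` UNIV) = dim (UNIV :: (real ^ ('d option)) set)"
      by (intro dim_image_eq) auto
    moreover have "dim ((*v) Q ` UNIV) \<le> dim (UNIV :: (real ^ 'd) set)"
      by (rule dim_subset) simp
    ultimately show False by simp
  qed
  then obtain v where v: "Q *v v = 0" "v \<noteq> 0"
    by (metis linear_injective_0 matrix_vector_mul_linear)
  define w where "w = (1 / norm v) *\<^sub>R v"
  have "norm w = 1" using v by (simp add: w_def)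
  then have w: "Q *v w = 0" "w \<bullet> w = 1"
    using v by (simp_all add: w_def[symmetric] norm_eq_1) (simp add: w_def matrix_vector_mult_scaleR)
  define M where "M = (\<chi> i. case i of None \<Rightarrow> w | Some j \<Rightarrow> Q $ j)"
  have M: "M $ None = w" "M $ Some j = Q $ j" for j by (simp_all add: M_def)
  have qq: "Q $ i \<bullet> Q $ j = (if i = j then 1 else 0)" for i j
  proof -
    have "(Q ** transpose Q) $ i $ j = Q $ i \<bullet> Q $ j"
      by (simp add: matrix_matrix_mult_def transpose_def inner_vec_def)
    then show ?thesis using Q by (simp add: mat_def)
  qed
  have qw: "Q $ i \<bullet> w = 0" for i
    using w(1) by (simp add: matrix_vector_mul_component[symmetric])
  have mm: "(M ** transpose M) $ i $ j = M $ i \<bullet> M $ j" for i j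
    by (simp add: matrix_matrix_mult_def transpose_def inner_vec_def)
  have wq: "w \<bullet> Q $ i = 0" for i using qw by (simp add: inner_commute)
  have "(M ** transpose M) $ i $ j = mat 1 $ i $ j" for i j
    by (cases i; cases j) (simp_all add: mm M qq qw wq w mat_def)
  then have "M ** transpose M = mat 1" by (simp add: vec_eq_iff)
  then have "orthogonal_matrix (transpose M)" by (simp add: orthogonal_matrix)
  then have "orthogonal_matrix M" by (simp add: orthogonal_matrix_transpose)
  then show ?thesis using that M by blast
qed

text \<open>Applying Q amounts to rotating and then dropping one coordinate, and either operation
  keeps the law standard normal.\<close>

lemma distr_std_gaussian_orthonormal_rows:
  fixes Q :: "real ^ ('d::finite option) ^ 'd"
  assumes Q: "Q ** transpose Q = mat 1"
  shows "distr std_gaussian borel ((*v) Q) = std_gaussian"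
proof -
  obtain M :: "real ^ ('d option) ^ ('d option)" where M: "orthogonal_matrix M" "\<And>i. M $ Some i = Q $ i"
    by (rule orthonormal_rows_extend[OF Q]) blast
  have "drop0 \<circ> (*v) M = (*v) Q"
    by (auto simp: fun_eq_iff drop0_def vec_eq_iff matrix_vector_mult_def M)
  then have "distr std_gaussian borel ((*v) Q) = distr (distr std_gaussian borel ((*v) M)) borel drop0"
    by (subst distr_distr) simp_all
  moreover have "orthogonal_transformation ((*v) M)"
    using M(1) by (simp add: orthogonal_transformation_matrix)
  ultimately show ?thesis
    by (simp add: distr_std_gaussian_orthogonal distr_std_gaussian_drop0)
qed

lemma matrix_inv_inverse:
  assumes "invertible A"
  shows "A ** matrix_inv A = mat 1" "matrix_inv A ** A = mat 1"
  using someI_ex[OF assms[unfolded invertible_def]] unfolding matrix_inv_def by auto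

text \<open>With Q = C^(-1) B one has B = C Q, and equality of the covariances says that Q has
  orthonormal rows. Thus Q Z is standard normal in d dimensions.\<close>

lemma distr_std_gaussian_eqI:
  fixes B :: "real ^ ('d::finite option) ^ 'd" and C :: "real ^ 'd ^ 'd"
  assumes C: "invertible C" and eq: "C ** transpose C = B ** transpose B"
  shows "distr std_gaussian borel ((*v) C) = distr std_gaussian borel ((*v) B)"
proof -
  define Q where "Q = matrix_inv C ** B"
  have inv: "C ** matrix_inv C = mat 1" "matrix_inv C ** C = mat 1"
    using C matrix_inv_inverse by auto
  have "Q ** transpose Q = matrix_inv C ** (C ** transpose C) ** transpose (matrix_inv C)"
    unfolding eq by (simp add: Q_def matrix_transpose_mul matrix_mul_assoc)
  also have "\<dots> = (matrix_inv C ** C) ** transpose (matrix_inv C ** C)"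
    by (simp only: matrix_transpose_mul matrix_mul_assoc)
  finally have Q: "Q ** transpose Q = mat 1" by (simp add: inv)
  have "C ** Q = B" by (simp add: Q_def matrix_mul_assoc inv)
  then have "(*v) C \<circ> (*v) Q = (*v) B" by (auto simp: fun_eq_iff matrix_vector_mul_assoc)
  then have "distr std_gaussian borel ((*v) B) = distr (distr std_gaussian borel ((*v) Q)) borel ((*v) C)"
    by (subst distr_distr) simp_all
  then show ?thesis by (simp add: distr_std_gaussian_orthonormal_rows[OF Q])
qed

text \<open>The two sides use unrelated square roots chosen by \<open>SOME\<close>, in d + 1 and in
  d dimensions. Deleting the row \<open>None\<close> of the larger one gives a d by (d + 1) factor
  of S', which is compared with the smaller one through the covariance. The larger matrix S may be
  singular; only S' is inverted.\<close>

lemma marginal0_gaussian: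
  fixes S :: "real ^ ('d::finite option) ^ ('d option)" and S' :: "real ^ 'd ^ 'd"
  assumes S: "\<exists>B :: real ^ ('d option) ^ ('d option). B ** transpose B = S"
    and S': "\<exists>C :: real ^ 'd ^ 'd. C ** transpose C = S'" "invertible S'"
    and sub: "\<And>i j. S' $ i $ j = S $ Some i $ Some j"
  shows "marginal0 (gaussian m S) = gaussian (drop0 m) S'"
proof -
  define B :: "real ^ ('d option) ^ ('d option)" where "B = (SOME A. A ** transpose A = S)"
  define C :: "real ^ 'd ^ 'd" where "C = (SOME A. A ** transpose A = S')"
  have B: "B ** transpose B = S" unfolding B_def by (rule someI_ex[OF S])
  have C: "C ** transpose C = S'" unfolding C_def by (rule someI_ex[OF S'(1)])
  define B' :: "real ^ ('d option) ^ 'd" where "B' = (\<chi> i. B $ Some i)"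
  have "invertible C"
    using S'(2) unfolding invertible_det_nz C[symmetric] det_mul by simp
  moreover have "C ** transpose C = B' ** transpose B'"
    unfolding C by (simp add: vec_eq_iff sub B[symmetric] B'_def matrix_matrix_mult_def transpose_def)
  ultimately have eq: "distr std_gaussian borel ((*v) C) = distr std_gaussian borel ((*v) B')"
    by (rule distr_std_gaussian_eqI)
  have "marginal0 (gaussian m S) = distr std_gaussian borel (\<lambda>z. drop0 (m + B *v z))"
    unfolding marginal0_def gaussian_def B_def[symmetric] by (subst distr_distr) (simp_all add: comp_def)
  also have "(\<lambda>z. drop0 (m + B *v z)) = (\<lambda>z. drop0 m + B' *v z)"
    by (auto simp: fun_eq_iff drop0_def vec_eq_iff B'_def matrix_vector_mult_def)
  also have "distr std_gaussian borel (\<lambda>z. drop0 m + B' *v z) = distr (distr std_gaussian borel ((*v) B')) borel (\<lambda>y. drop0 m + y)"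
    by (subst distr_distr) (simp_all add: comp_def)
  also have "\<dots> = gaussian (drop0 m) S'"
    unfolding eq[symmetric] gaussian_def C_def[symmetric] by (subst distr_distr) (simp_all add: comp_def)
  finally show ?thesis .
qed

lemma prob_space_gaussian: "prob_space (gaussian m S)"
  unfolding gaussian_def by (intro prob_space.prob_space_distr prob_space_std_gaussian) simp

text \<open>Reflection at the origin exchanges the two disjoint half-spaces. Only an inequality is
  claimed, which covers h = 0.\<close>

lemma measure_std_gaussian_halfspace_le:
  fixes h :: "real ^ 'n::finite \<Rightarrow> real"
  assumes h: "linear h"
  shows "measure std_gaussian {z. 0 < h z} \<le> 1 / 2"
proof -
  interpret prob_space "std_gaussian :: (real ^ 'n) measure" by (rule prob_space_std_gaussian)
  have [measurable]: "h \<in> borel_measurable borel"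
    using h by (intro borel_measurable_continuous_onI linear_continuous_on) (simp add: linear_conv_bounded_linear)
  have "orthogonal_transformation (uminus :: real ^ 'n \<Rightarrow> _)"
    by (simp add: orthogonal_transformation_def linear_iff)
  then have "measure std_gaussian {z. 0 < h z} = measure (distr std_gaussian borel uminus) {z :: real ^ 'n. 0 < h z}"
    by (simp add: distr_std_gaussian_orthogonal)
  also have "\<dots> = measure std_gaussian {z. h z < 0}"
    using linear_neg[OF h] by (subst measure_distr) (auto simp: vimage_def)
  finally have eq: "prob {z. 0 < h z} = prob {z. h z < 0}" .
  have "prob {z. 0 < h z} + prob {z. h z < 0} = prob ({z. 0 < h z} \<union> {z. h z < 0})"
    by (rule finite_measure_Union[symmetric]) auto
  also have "\<dots> \<le> 1" by simp
  finally show ?thesis using eq by simp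
qed

text \<open>No condition on S appears, because the symmetry about m is present for whatever matrix
  \<open>SOME\<close> returns.\<close>

lemma measure_gaussian_halfspace_le:
  fixes h :: "real ^ 'n::finite \<Rightarrow> real"
  assumes h: "linear h"
  shows "measure (gaussian m S) {x. h m < h x} \<le> 1 / 2"
proof -
  define A :: "real ^ 'n ^ 'n" where "A = (SOME A. A ** transpose A = S)"
  have [measurable]: "h \<in> borel_measurable borel"
    using h by (intro borel_measurable_continuous_onI linear_continuous_on) (simp add: linear_conv_bounded_linear)
  have "measure (gaussian m S) {x. h m < h x} = measure std_gaussian {z. 0 < (h \<circ> (*v) A) z}"
    unfolding gaussian_def A_def[symmetric]
    by (subst measure_distr) (auto simp: vimage_def linear_add[OF h])
  also have "\<dots> \<le> 1 / 2"
    by (intro measure_std_gaussian_halfspace_le linear_compose h) simp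
  finally show ?thesis .
qed

section \<open>The Laplace approximation\<close>

lemma vec_lambda_has_derivative:
  fixes f :: "'a::euclidean_space \<Rightarrow> 'n::finite \<Rightarrow> real"
  assumes "\<And>i. ((\<lambda>x. f x i) has_derivative (\<lambda>h. f' h i)) (at x)"
  shows "((\<lambda>x. \<chi> i. f x i) has_derivative (\<lambda>h. \<chi> i. f' h i)) (at x)"
proof (subst has_derivative_componentwise_within, intro ballI)
  fix b :: "real ^ 'n" assume "b \<in> Basis"
  then obtain i where "b = axis i 1" by (auto simp: Basis_vec_def)
  then show "((\<lambda>x. (\<chi> i. f x i) \<bullet> b) has_derivative (\<lambda>h. (\<chi> i. f' h i) \<bullet> b)) (at x)"
    using assms[of i] by (simp add: inner_axis)
qed

text \<open>The linear part of the affine map \<open>simplex_point\<close>, hence its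
  derivative.\<close>

definition simplex_dir :: "real ^ 'd \<Rightarrow> real ^ ('d::finite option)" where
  "simplex_dir h = (\<chi> j. case j of None \<Rightarrow> - (\<Sum>i\<in>UNIV. h $ i) | Some i \<Rightarrow> h $ i)"

lemma simplex_point_nth [simp]:
  "simplex_point x $ None = 1 - (\<Sum>i\<in>UNIV. x $ i)" "simplex_point x $ Some i = x $ i"
  by (simp_all add: simplex_point_def)

lemma simplex_dir_nth [simp]:
  "simplex_dir h $ None = - (\<Sum>i\<in>UNIV. h $ i)" "simplex_dir h $ Some i = h $ i"
  by (simp_all add: simplex_dir_def)

lemma simplex_point_has_derivative:
  "((\<lambda>x. simplex_point x $ j) has_derivative (\<lambda>h. simplex_dir h $ j)) (at x)"
  by (cases j) (auto intro!: derivative_eq_intros bounded_linear.has_derivative[OF bounded_linear_vec_nth])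

lemma simplex_point_drop0:
  assumes "(\<Sum>j\<in>UNIV. p $ j) = 1"
  shows "simplex_point (drop0 p) = p"
  using assms by (auto simp: vec_eq_iff split_option_all drop0_def sum_UNIV_option)

lemma open_simplex_interior: "open {x :: real ^ 'd::finite. \<forall>j. 0 < simplex_point x $ j}"
proof -
  have "continuous_on UNIV (\<lambda>x :: real ^ 'd. simplex_point x $ j)" for j
    by (cases j) (auto intro!: continuous_intros)
  then have "open {x :: real ^ 'd. 0 < simplex_point x $ j}" for j
    by (intro open_Collect_less continuous_on_const)
  then have "open (\<Inter>j\<in>UNIV. {x :: real ^ 'd. 0 < simplex_point x $ j})"
    by (intro open_INT) auto
  moreover have "(\<Inter>j\<in>UNIV. {x :: real ^ 'd. 0 < simplex_point x $ j}) = {x. \<forall>j. 0 < simplex_point x $ j}"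
    by auto
  ultimately show ?thesis by simp
qed

text \<open>The covariance of one multinomial draw. The entries of q need not sum to 1: it is used
  for all d + 1 probabilities as well as for the last d of them.\<close>

definition multinomial_cov :: "real ^ 'n::finite \<Rightarrow> real ^ 'n ^ 'n" where
  "multinomial_cov q = (\<chi> i j. (if i = j then q $ i else 0) - q $ i * q $ j)"

text \<open>With w = sqrt q taken entrywise, the factor is sqrt r (diag w - c q w^T). Multiplying
  out gives r (diag q - (2 c - c^2 \<Sum>q) q q^T), so the condition on c makes the coefficient of q
  q^T equal to 1.\<close>

lemma multinomial_cov_sqrt:
  fixes q :: "real ^ 'n::finite"
  assumes q: "\<And>i. 0 \<le> q $ i" and r: "0 \<le> r" and c: "2 * c - c\<^sup>2 * (\<Sum>i\<in>UNIV. q $ i) = 1"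
  shows "\<exists>A :: real ^ 'n ^ 'n. A ** transpose A = r *\<^sub>R multinomial_cov q"
proof
  define w where "w i = sqrt (q $ i)" for i
  have w: "w i * w i = q $ i" for i using q by (simp add: w_def)
  have rr: "(sqrt r * a) * (sqrt r * b) = r * a * b" for a b
  proof -
    have "(sqrt r * a) * (sqrt r * b) = (sqrt r * sqrt r) * a * b" by (simp only: mult_ac)
    then show ?thesis using r by simp
  qed
  define A :: "real ^ 'n ^ 'n" where "A = (\<chi> i k. sqrt r * ((if i = k then w i else 0) - c * q $ i * w k))"
  have "(A ** transpose A) $ i $ j = (r *\<^sub>R multinomial_cov q) $ i $ j" for i j
  proof -
    have "(A ** transpose A) $ i $ j
      = (\<Sum>k\<in>UNIV. r * ((if i = k then w i else 0) - c * q $ i * w k) * ((if j = k then w j else 0) - c * q $ j * w k))"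
      by (simp add: A_def matrix_matrix_mult_def transpose_def rr)
    also have "\<dots> = (\<Sum>k\<in>UNIV. r * ((if i = k then (if i = j then q $ i else 0) - c * q $ i * q $ j else 0)
        + (if j = k then - c * q $ i * q $ j else 0) + c\<^sup>2 * q $ i * q $ j * q $ k))"
    proof (rule sum.cong[OF refl])
      fix k
      show "r * ((if i = k then w i else 0) - c * q $ i * w k) * ((if j = k then w j else 0) - c * q $ j * w k)
        = r * ((if i = k then (if i = j then q $ i else 0) - c * q $ i * q $ j else 0)
        + (if j = k then - c * q $ i * q $ j else 0) + c\<^sup>2 * q $ i * q $ j * q $ k)"
        by (auto simp: w[symmetric] power2_eq_square algebra_simps)
    qed
    also have "\<dots> = r * ((if i = j then q $ i else 0) - (2 * c - c\<^sup>2 * (\<Sum>k\<in>UNIV. q $ k)) * (q $ i * q $ j))"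
      by (simp add: sum_distrib_left[symmetric] sum.distrib) (simp add: algebra_simps)
    finally show ?thesis by (simp add: c multinomial_cov_def)
  qed
  then show "A ** transpose A = r *\<^sub>R multinomial_cov q" by (simp add: vec_eq_iff)
qed

lemma matrix_inv_eqI:
  fixes A B :: "real ^ 'n::finite ^ 'n"
  assumes "A ** B = mat 1"
  shows "invertible A" "invertible B" "matrix_inv A = B"
proof -
  have BA: "B ** A = mat 1" using assms by (simp add: matrix_left_right_inverse)
  show A: "invertible A" and "invertible B" using assms BA by (auto simp: invertible_def)
  have "matrix_inv A = matrix_inv A ** (A ** B)" by (simp add: assms)
  also have "\<dots> = B" by (simp add: matrix_mul_assoc matrix_inv_inverse[OF A])
  finally show "matrix_inv A = B" .
qed

section \<open>Mode and curvature of the Dirichlet density with positive counts\<close>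

locale multinomial_counts =
  fixes N :: "'d::finite option \<Rightarrow> nat" and n :: nat and p :: "real ^ ('d option)"
  assumes N_pos: "\<And>j. 0 < N j"
    and n_def: "n = (\<Sum>j\<in>UNIV. N j)"
    and p_def: "p = (\<chi> j. real (N j) / real n)"
begin

abbreviation f :: "real ^ 'd \<Rightarrow> real" where "f \<equiv> dirichlet_density (\<chi> j. real (N j) + 1)"
abbreviation V :: "real ^ 'd \<Rightarrow> real" where "V \<equiv> \<lambda>x. - ln (f x)"
abbreviation inner_simplex :: "(real ^ 'd) set" where "inner_simplex \<equiv> {x. \<forall>j. 0 < simplex_point x $ j}"

lemma n_pos: "0 < n"
  unfolding n_def using N_pos by (intro sum_pos) auto

lemma p_pos: "0 < p $ j"
  using N_pos n_pos by (simp add: p_def)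

lemma N_eq: "real (N j) = real n * p $ j"
  using n_pos by (simp add: p_def)

lemma sum_p: "(\<Sum>j\<in>UNIV. p $ j) = 1"
proof -
  have "(\<Sum>j\<in>UNIV. p $ j) = (\<Sum>j\<in>UNIV. real (N j)) / real n" by (simp add: p_def sum_divide_distrib)
  also have "(\<Sum>j\<in>UNIV. real (N j)) = real n" by (simp add: n_def)
  finally show ?thesis using n_pos by simp
qed

lemma simplex_point_p: "simplex_point (drop0 p) = p"
  by (rule simplex_point_drop0[OF sum_p])

lemma p_inner: "drop0 p \<in> inner_simplex"
  by (simp add: simplex_point_p p_pos)

lemma f_eq:
  obtains C where "0 < C" "\<And>x. x \<in> inner_simplex \<Longrightarrow> f x = C * (\<Prod>j\<in>UNIV. simplex_point x $ j powr real (N j))"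
proof
  show "0 < Gamma (\<Sum>j\<in>UNIV. real (N j) + 1) / (\<Prod>j\<in>UNIV. Gamma (real (N j) + 1))"
    by (intro divide_pos_pos Gamma_real_pos prod_pos ballI sum_pos) (auto intro: add_nonneg_pos)
qed (simp add: dirichlet_density_def)

lemma f_pos_iff: "0 < f x \<longleftrightarrow> x \<in> inner_simplex"
proof
  assume x: "x \<in> inner_simplex"
  then have "simplex_point x $ j \<noteq> 0" for j by (metis (mono_tags) less_irrefl mem_Collect_eq)
  moreover obtain C where C: "0 < C" "\<And>x. x \<in> inner_simplex \<Longrightarrow> f x = C * (\<Prod>j\<in>UNIV. simplex_point x $ j powr real (N j))"
    by (rule f_eq) blast
  ultimately show "0 < f x" by (simp add: C(2)[OF x] prod_pos)
qed (auto simp: dirichlet_density_def split: if_splits)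

lemma V_eq:
  obtains K where "\<And>x. x \<in> inner_simplex \<Longrightarrow> V x = K - (\<Sum>j\<in>UNIV. real (N j) * ln (simplex_point x $ j))"
proof -
  obtain C where C: "0 < C" "\<And>x. x \<in> inner_simplex \<Longrightarrow> f x = C * (\<Prod>j\<in>UNIV. simplex_point x $ j powr real (N j))"
    by (rule f_eq) blast
  have "V x = - ln C - (\<Sum>j\<in>UNIV. real (N j) * ln (simplex_point x $ j))" if x: "x \<in> inner_simplex" for x
  proof -
    have x': "0 < simplex_point x $ j" for j using x by simp
    then have nz: "simplex_point x $ j \<noteq> 0" for j by (metis less_irrefl)
    then have "0 < (\<Prod>j\<in>UNIV. simplex_point x $ j powr real (N j))"
      by (intro prod_pos) simp
    then have "ln (f x) = ln C + ln (\<Prod>j\<in>UNIV. simplex_point x $ j powr real (N j))"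
      using C(1) nz by (simp add: C(2)[OF x] ln_mult)
    also have "ln (\<Prod>j\<in>UNIV. simplex_point x $ j powr real (N j)) = (\<Sum>j\<in>UNIV. real (N j) * ln (simplex_point x $ j))"
      using nz by (subst ln_prod) (auto simp: ln_powr)
    finally show ?thesis by simp
  qed
  then show thesis by (rule that)
qed

text \<open>Gibbs' inequality: the difference V(y) - V(p) is n times the relative entropy of p with
  respect to \<theta>. It is positive because ln z \<le> z - 1, with equality only at z = 1.\<close>

lemma V_minimizer:
  assumes y: "y \<in> inner_simplex" "y \<noteq> drop0 p"
  shows "V (drop0 p) < V y"
proof -
  obtain K where K: "\<And>x. x \<in> inner_simplex \<Longrightarrow> V x = K - (\<Sum>j\<in>UNIV. real (N j) * ln (simplex_point x $ j))"
    by (rule V_eq) blast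
  let ?\<theta> = "simplex_point y"
  have \<theta>: "0 < ?\<theta> $ j" for j using y by simp
  have "?\<theta> \<noteq> p" using y(2) by (metis drop0_simplex_point)
  then obtain j where j: "?\<theta> $ j \<noteq> p $ j" by (auto simp: vec_eq_iff)
  have le: "ln (?\<theta> $ i / p $ i) \<le> ?\<theta> $ i / p $ i - 1" for i
    using \<theta> p_pos by (intro ln_le_minus_one divide_pos_pos)
  have "ln (?\<theta> $ j / p $ j) \<noteq> ?\<theta> $ j / p $ j - 1"
    using ln_eq_minus_one[of "?\<theta> $ j / p $ j"] \<theta>[of j] p_pos[of j] j by auto
  then have lt: "ln (?\<theta> $ j / p $ j) < ?\<theta> $ j / p $ j - 1" using le[of j] by simp
  have "(\<Sum>i\<in>UNIV. real (N i) * ln (?\<theta> $ i / p $ i)) < (\<Sum>i\<in>UNIV. real (N i) * (?\<theta> $ i / p $ i - 1))"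
    using le lt N_pos by (intro sum_strict_mono_ex1) (auto intro!: mult_left_mono)
  also have "\<dots> = (\<Sum>i\<in>UNIV. real n * (?\<theta> $ i - p $ i))"
    using p_pos by (intro sum.cong) (auto simp: N_eq field_simps less_imp_neq[THEN not_sym])
  also have "\<dots> = 0"
    by (simp add: sum_distrib_left[symmetric] sum_subtractf sum_p sum_simplex_point)
  finally have "(\<Sum>i\<in>UNIV. real (N i) * ln (?\<theta> $ i)) < (\<Sum>i\<in>UNIV. real (N i) * ln (p $ i))"
    using \<theta> p_pos by (simp add: ln_div less_imp_neq[THEN not_sym] right_diff_distrib sum_subtractf)
  then show ?thesis
    using K[OF y(1)] K[OF p_inner] by (simp add: simplex_point_p)
qed

text \<open>The formula is needed on the whole open simplex, not just at the mode, since the Hessian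
  is obtained by differentiating it.\<close>

lemma gradient_V:
  assumes x: "x \<in> inner_simplex"
  shows "gradient V x = (\<chi> i. real (N None) / simplex_point x $ None - real (N (Some i)) / simplex_point x $ Some i)"
proof -
  obtain K where K: "\<And>x. x \<in> inner_simplex \<Longrightarrow> V x = K - (\<Sum>j\<in>UNIV. real (N j) * ln (simplex_point x $ j))"
    by (rule V_eq) blast
  have x': "0 < simplex_point x $ j" for j using x by simp
  let ?D = "\<lambda>h. - (\<Sum>j\<in>UNIV. real (N j) * (simplex_dir h $ j / simplex_point x $ j))"
  have "((\<lambda>x. K - (\<Sum>j\<in>UNIV. real (N j) * ln (simplex_point x $ j))) has_derivative ?D) (at x)"
    using x' by (auto intro!: derivative_eq_intros simplex_point_has_derivative simp: divide_inverse mult_ac)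
  then have "(V has_derivative ?D) (at x)"
    by (rule has_derivative_transform_within_open[OF _ open_simplex_interior x]) (rule K[symmetric])
  then have D: "frechet_derivative V (at x) = ?D"
    by (rule frechet_derivative_at[symmetric])
  show ?thesis
    unfolding gradient_def D
    by (simp add: vec_eq_iff sum_UNIV_option axis_def if_distrib[of "\<lambda>z. z / _"] if_distrib[of "\<lambda>z. _ * z"] cong: if_cong)
qed

text \<open>The dependent coordinate 1 - \<Sum>x contributes the constant matrix with entries 1 /
  p_0, the others a diagonal. The counts cancel one power of p by \<open>N_eq\<close>.\<close>

lemma hessian_V:
  "hessian V (drop0 p) = real n *\<^sub>R (\<chi> i j. 1 / p $ None + (if i = j then 1 / p $ Some i else 0))" (is "_ = ?H")
proof -
  let ?x = "drop0 p"
  let ?g = "\<lambda>x. \<chi> i. real (N None) / simplex_point x $ None - real (N (Some i)) / simplex_point x $ Some i"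
  have pn: "p $ j \<noteq> 0" for j using p_pos[of j] by simp
  have "(?g has_derivative (\<lambda>h. \<chi> i. real (N (Some i)) * simplex_dir h $ Some i / (p $ Some i)\<^sup>2
      - real (N None) * simplex_dir h $ None / (p $ None)\<^sup>2)) (at ?x)"
    by (rule vec_lambda_has_derivative)
      (auto intro!: derivative_eq_intros simplex_point_has_derivative simp del: simplex_point_nth simplex_dir_nth
        simp: simplex_point_p pn divide_inverse power2_eq_square mult_ac fun_eq_iff)
  also have "(\<lambda>h. \<chi> i. real (N (Some i)) * simplex_dir h $ Some i / (p $ Some i)\<^sup>2
      - real (N None) * simplex_dir h $ None / (p $ None)\<^sup>2) = (*v) ?H"
  proof (rule ext, unfold vec_eq_iff, intro allI)
    fix h i
    have "(?H *v h) $ i = (\<Sum>j\<in>UNIV. real n / p $ None * h $ j + (if i = j then real n / p $ Some i * h $ i else 0))"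
      by (auto simp: matrix_vector_mult_def algebra_simps intro!: sum.cong)
    also have "\<dots> = real n / p $ None * (\<Sum>j\<in>UNIV. h $ j) + real n / p $ Some i * h $ i"
      by (simp add: sum.distrib sum_distrib_left)
    finally show "(\<chi> i. real (N (Some i)) * simplex_dir h $ Some i / (p $ Some i)\<^sup>2
      - real (N None) * simplex_dir h $ None / (p $ None)\<^sup>2) $ i = (?H *v h) $ i"
      by (simp add: N_eq power2_eq_square pn)
  qed
  finally have "(gradient V has_derivative (*v) ?H) (at ?x)"
    by (rule has_derivative_transform_within_open[OF _ open_simplex_interior p_inner]) (rule gradient_V[symmetric])
  then have "frechet_derivative (gradient V) (at ?x) = (*v) ?H"
    by (rule frechet_derivative_at[symmetric])
  then show ?thesis
    unfolding hessian_def jacobian_def by (simp only: matrix_of_matrix_vector_mul)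
qed

text \<open>The Sherman-Morrison formula for a diagonal matrix plus a matrix of rank one. Because
  p_0 and the other probabilities sum to 1, the coefficient of the rank-one correction is 1.\<close>

lemma hessian_V_mult_cov: "hessian V (drop0 p) ** ((1 / real n) *\<^sub>R multinomial_cov (drop0 p)) = mat 1"
proof -
  have pn: "p $ j \<noteq> 0" for j using p_pos[of j] by simp
  have q: "(\<Sum>k\<in>UNIV. p $ Some k) = 1 - p $ None" using sum_p by (simp add: sum_UNIV_option)
  have "(hessian V (drop0 p) ** ((1 / real n) *\<^sub>R multinomial_cov (drop0 p))) $ i $ j = mat 1 $ i $ j" for i j
  proof -
    have "(hessian V (drop0 p) ** ((1 / real n) *\<^sub>R multinomial_cov (drop0 p))) $ i $ j
      = (\<Sum>k\<in>UNIV. (1 / p $ None + (if i = k then 1 / p $ Some i else 0))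
          * ((if k = j then p $ Some k else 0) - p $ Some k * p $ Some j))"
      unfolding hessian_V using n_pos by (simp add: matrix_matrix_mult_def multinomial_cov_def drop0_def cong: if_cong)
    also have "\<dots> = (\<Sum>k\<in>UNIV. (if k = j then 1 / p $ None * p $ Some j else 0) - 1 / p $ None * p $ Some j * p $ Some k
        + (if i = k then (if i = j then 1 else 0) - p $ Some j else 0))"
      by (rule sum.cong) (auto simp: pn field_simps)
    also have "\<dots> = 1 / p $ None * p $ Some j - 1 / p $ None * p $ Some j * (1 - p $ None) + ((if i = j then 1 else 0) - p $ Some j)"
    proof -
      have "(\<Sum>k\<in>UNIV. 1 / p $ None * p $ Some j * p $ Some k) = 1 / p $ None * p $ Some j * (1 - p $ None)"
        unfolding sum_distrib_left[symmetric] q ..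
      then show ?thesis by (simp only: sum.distrib sum_subtractf sum.delta sum.delta' finite UNIV_I if_True)
    qed
    also have "\<dots> = (if i = j then 1 else 0)" using pn[of None] by (simp add: field_simps)
    finally show ?thesis by (simp add: mat_def)
  qed
  then show ?thesis by (simp add: vec_eq_iff)
qed

lemma laplace_approx_f:
  "laplace_approx f = gaussian (drop0 p) ((1 / real n) *\<^sub>R multinomial_cov (drop0 p))"
proof -
  have "(THE x. 0 < f x \<and> (\<forall>y. 0 < f y \<and> y \<noteq> x \<longrightarrow> V x < V y)) = drop0 p"
  proof (rule the_equality)
    show "0 < f (drop0 p) \<and> (\<forall>y. 0 < f y \<and> y \<noteq> drop0 p \<longrightarrow> V (drop0 p) < V y)"
      using p_inner V_minimizer unfolding f_pos_iff by blast
    fix x assume x: "0 < f x \<and> (\<forall>y. 0 < f y \<and> y \<noteq> x \<longrightarrow> V x < V y)"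
    show "x = drop0 p"
    proof (rule ccontr)
      assume "x \<noteq> drop0 p"
      then have "V x < V (drop0 p)" "V (drop0 p) < V x"
        using x p_inner V_minimizer[of x] unfolding f_pos_iff by auto
      then show False by simp
    qed
  qed
  then show ?thesis
    unfolding laplace_approx_def Let_def using matrix_inv_eqI(3)[OF hessian_V_mult_cov] by simp
qed

lemma laplace_approx_f_eq_marginal0:
  "laplace_approx f = marginal0 (gaussian p ((1 / real n) *\<^sub>R multinomial_cov p))"
proof -
  have q: "(\<Sum>i\<in>UNIV. drop0 p $ i) = 1 - p $ None"
    using sum_p by (simp add: sum_UNIV_option drop0_def)
  have p0: "0 \<le> p $ j" "0 \<le> drop0 p $ i" for i j
    using p_pos by (auto simp: drop0_def less_imp_le)
  define t where "t = sqrt (p $ None)"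
  have t: "0 \<le> t" "p $ None = t\<^sup>2" using p0(1)[of None] by (auto simp: t_def)
  \<comment> \<open>The last d probabilities sum to 1 - t^2, and c = 1 / (1 + t) is a root of the
    quadratic equation in \<open>multinomial_cov_sqrt\<close>. For all d + 1 probabilities the sum
    is 1 and c = 1 is the root.\<close>
  have c: "2 * (1 / (1 + t)) - (1 / (1 + t))\<^sup>2 * (\<Sum>i\<in>UNIV. drop0 p $ i) = 1"
  proof -
    have "1 - t\<^sup>2 = (1 + t) * (1 - t)" by (simp add: power2_eq_square algebra_simps)
    then have "(1 / (1 + t))\<^sup>2 * (1 - t\<^sup>2) = (1 - t) / (1 + t)" using t(1) by (simp add: power2_eq_square)
    then show ?thesis using t(1) unfolding q t(2) by (simp add: diff_divide_distrib[symmetric])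
  qed
  have "marginal0 (gaussian p ((1 / real n) *\<^sub>R multinomial_cov p)) = gaussian (drop0 p) ((1 / real n) *\<^sub>R multinomial_cov (drop0 p))"
  proof (rule marginal0_gaussian)
    show "\<exists>B :: real ^ ('d option) ^ ('d option). B ** transpose B = (1 / real n) *\<^sub>R multinomial_cov p"
      by (rule multinomial_cov_sqrt[where c = 1]) (simp_all add: p0 sum_p)
    show "\<exists>C :: real ^ 'd ^ 'd. C ** transpose C = (1 / real n) *\<^sub>R multinomial_cov (drop0 p)"
      by (rule multinomial_cov_sqrt[OF _ _ c]) (simp_all add: p0)
    show "invertible ((1 / real n) *\<^sub>R multinomial_cov (drop0 p))"
      by (rule matrix_inv_eqI(2)[OF hessian_V_mult_cov])
  qed (simp add: multinomial_cov_def drop0_def)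
  then show ?thesis by (simp add: laplace_approx_f)
qed

end

section \<open>Total variation distance\<close>

lemma tv_dist_ge:
  assumes M: "prob_space M" and K: "prob_space K" and A: "A \<in> sets M"
  shows "measure M A - measure K A \<le> tv_dist M K"
proof -
  interpret M: prob_space M by fact
  interpret K: prob_space K by fact
  have "\<bar>measure M B - measure K B\<bar> \<le> 1" for B
    using M.prob_le_1[of B] K.prob_le_1[of B] measure_nonneg[of M B] measure_nonneg[of K B] by linarith
  then have "bdd_above ((\<lambda>B. \<bar>measure M B - measure K B\<bar>) ` sets M)" by (auto intro!: bdd_aboveI2)
  then have "\<bar>measure M A - measure K A\<bar> \<le> tv_dist M K"
    unfolding tv_dist_def by (rule cSUP_upper[OF A])
  then show ?thesis by simp
qed

text \<open>The supremum is attained at the set where P exceeds Q, since the differences sum to 0.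
  The first form is the one in the theorem; the second ties the distance to the set A that defines
  the half-space.\<close>

lemma tv_dist_pmf:
  fixes P Q :: "'a::finite pmf"
  defines "\<delta> j \<equiv> pmf P j - pmf Q j"
  shows "tv_dist (measure_pmf P) (measure_pmf Q) = 1 / 2 * (\<Sum>j\<in>UNIV. \<bar>\<delta> j\<bar>)"
    and "tv_dist (measure_pmf P) (measure_pmf Q) = (\<Sum>j | 0 < \<delta> j. \<delta> j)"
proof -
  let ?B = "{j. 0 < \<delta> j}"
  have m: "measure (measure_pmf P) A - measure (measure_pmf Q) A = sum \<delta> A" for A
    by (simp add: measure_measure_pmf_finite sum_subtractf \<delta>_def)
  have split: "sum h UNIV = sum h A + sum h (- A)" for h :: "'a \<Rightarrow> real" and A
    by (subst sum.union_disjoint[symmetric]) (auto intro!: sum.cong)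
  have "sum \<delta> UNIV = 0"
    using sum_pmf_eq_1[of UNIV P] sum_pmf_eq_1[of UNIV Q] by (simp add: \<delta>_def sum_subtractf)
  then have neg: "sum \<delta> (- A) = - sum \<delta> A" for A using split[of \<delta> A] by simp
  have le: "\<bar>sum \<delta> A\<bar> \<le> 1 / 2 * (\<Sum>j\<in>UNIV. \<bar>\<delta> j\<bar>)" for A
  proof -
    have "\<bar>sum \<delta> A\<bar> \<le> (\<Sum>j\<in>A. \<bar>\<delta> j\<bar>)" "\<bar>sum \<delta> (- A)\<bar> \<le> (\<Sum>j\<in>-A. \<bar>\<delta> j\<bar>)"
      by (rule sum_abs)+
    then show ?thesis using split[of "\<lambda>j. \<bar>\<delta> j\<bar>" A] neg[of A] by linarith
  qed
  have "(\<Sum>j\<in>?B. \<bar>\<delta> j\<bar>) = sum \<delta> ?B" by (rule sum.cong) auto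
  moreover have "(\<Sum>j\<in>-?B. \<bar>\<delta> j\<bar>) = - sum \<delta> (-?B)"
    unfolding sum_negf[symmetric] by (rule sum.cong) auto
  ultimately have eq: "sum \<delta> ?B = 1 / 2 * (\<Sum>j\<in>UNIV. \<bar>\<delta> j\<bar>)"
    using split[of "\<lambda>j. \<bar>\<delta> j\<bar>" ?B] neg[of ?B] by simp
  show "tv_dist (measure_pmf P) (measure_pmf Q) = 1 / 2 * (\<Sum>j\<in>UNIV. \<bar>\<delta> j\<bar>)"
    unfolding tv_dist_def m
  proof (rule cSup_eq_maximum)
    show "1 / 2 * (\<Sum>j\<in>UNIV. \<bar>\<delta> j\<bar>) \<in> (\<lambda>A. \<bar>sum \<delta> A\<bar>) ` sets (measure_pmf P)"
    proof (rule image_eqI)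
      have "0 \<le> sum \<delta> ?B" by (rule sum_nonneg) auto
      then show "1 / 2 * (\<Sum>j\<in>UNIV. \<bar>\<delta> j\<bar>) = \<bar>sum \<delta> ?B\<bar>" using eq by linarith
    qed simp
  qed (use le in auto)
  then show "tv_dist (measure_pmf P) (measure_pmf Q) = sum \<delta> ?B" by (simp add: eq)
qed

theorem theorem4p6:
  fixes N :: "'d::finite option \<Rightarrow> nat"
    and n :: nat
    and p :: "real ^ ('d option)"
    and p_min tv_unif :: real
    and pi_d gamma_d :: "(real ^ 'd) measure"
  assumes n: "n = (\<Sum>j\<in>UNIV. N j)"
    and p: "p = (\<chi> j. real (N j) / real n)"
    and p_min: "p_min = Min (range (\<lambda>j. p $ j))"
    and tv_unif: "tv_unif =
      tv_dist (measure_pmf (pmf_of_set UNIV)) (measure_pmf (embed_pmf (\<lambda>j. p $ j)))"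
    and pi_d: "pi_d = marginal0 (dirichlet (\<chi> j. real (N j) + 1))"
    and gamma_d: "gamma_d = laplace_approx (dirichlet_density (\<chi> j. real (N j) + 1))"
    and p_min_ge: "p_min \<ge> 6 / sqrt (real n + real CARD('d))"
    and tv_unif_ge: "tv_unif \<ge> 6 / (real CARD('d) + 1)"
  shows "tv_unif = 1 / 2 * (\<Sum>j\<in>UNIV. \<bar>1 / (real CARD('d) + 1) - p $ j\<bar>)
    \<and> gamma_d = marginal0 (gaussian p
        ((1 / real n) *\<^sub>R (\<chi> i j. (if i = j then p $ i else 0) - p $ i * p $ j)))
    \<and> tv_dist pi_d gamma_d \<ge> 1 / 9 * tv_unif * (real CARD('d) / sqrt (real n))"
proof -
  define D where "D = real CARD('d) + 1"
  define L where "L = n + CARD('d)"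
  have D: "CARD('d option) = CARD('d) + 1" "1 < D" by (simp_all add: D_def)
  have L: "0 < L" by (simp add: L_def)
  have p_ge: "6 / sqrt (real L) \<le> p $ j" for j
  proof -
    have "p_min \<le> p $ j" unfolding p_min by (rule Min_le) auto
    then show ?thesis using p_min_ge by (simp add: L_def)
  qed
  have p_gt: "0 < p $ j" for j
    by (rule less_le_trans[OF _ p_ge]) (use L in simp)
  \<comment> \<open>The bound on \<open>p_min\<close> excludes empty states, so the mode is an
    interior point of the simplex.\<close>
  have N_pos: "0 < N j" for j using p_gt[of j] by (cases "N j = 0") (auto simp: p)
  interpret multinomial_counts N n p by unfold_locales (rule N_pos n p)+

  have pmf_p: "pmf (embed_pmf (\<lambda>j. p $ j)) j = p $ j" for j
    using p_gt sum_p by (intro pmf_embed_pmf) (auto simp: less_imp_le nn_integral_count_space_finite sum_ennreal)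
  have pmf_u: "pmf (pmf_of_set UNIV) j = 1 / D" for j :: "'d option"
    by (simp add: D_def add.commute)
  have tv1: "tv_unif = 1 / 2 * (\<Sum>j\<in>UNIV. \<bar>1 / (real CARD('d) + 1) - p $ j\<bar>)"
    unfolding tv_unif tv_dist_pmf(1) pmf_p pmf_u by (simp add: D_def)
  define A where "A = {j. 0 < 1 / D - p $ j}"
  have tv2: "tv_unif = (\<Sum>j\<in>A. 1 / D - p $ j)"
    unfolding tv_unif tv_dist_pmf(2) pmf_p pmf_u A_def ..
  have gamma: "gamma_d = marginal0 (gaussian p ((1 / real n) *\<^sub>R multinomial_cov p))"
    "gamma_d = gaussian (drop0 p) ((1 / real n) *\<^sub>R multinomial_cov (drop0 p))"
    unfolding gamma_d by (rule laplace_approx_f_eq_marginal0 laplace_approx_f)+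

  define k where "k = real (card A)"
  define x where "x = (\<Sum>j\<in>A. p $ j)"
  define s where "s = D * tv_unif"
  have s: "s = k - D * x"
    using D by (simp add: s_def tv2 k_def x_def sum_subtractf right_diff_distrib)
  have s6: "6 \<le> s"
    using tv_unif_ge D by (simp add: s_def D_def field_simps)
  have split: "sum h UNIV = sum h A + sum h (- A)" for h :: "'d option \<Rightarrow> real"
    by (subst sum.union_disjoint[symmetric]) (auto intro!: sum.cong)
  have kD: "k \<le> D"
    using card_mono[of UNIV A] D by (simp add: k_def D_def)
  have A_ne: "A \<noteq> {}" using s s6 by (auto simp: k_def x_def)
  have A_ne': "A \<noteq> UNIV"
  proof
    assume "A = UNIV"
    then have "s = 0" using s D by (simp add: k_def x_def sum_p D_def)
    then show False using s6 by simp
  qed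
  have x0: "0 < x" unfolding x_def using A_ne p_gt by (intro sum_pos) auto
  have "0 < (\<Sum>j\<in>-A. p $ j)" using A_ne' p_gt by (intro sum_pos) auto
  then have x1: "x < 1" using split[of "\<lambda>j. p $ j"] sum_p by (simp add: x_def)
  have sD: "s \<le> D * (1 - x)" using s kD by (simp add: right_diff_distrib)
  \<comment> \<open>Summing the lower bound 6 / sqrt L over all D states, whose probabilities add up
    to 1, limits the dimension: 6 D \<le> sqrt L.\<close>
  have "real (card (UNIV :: 'd option set)) * (6 / sqrt (real L)) \<le> (\<Sum>j\<in>UNIV. p $ j)"
    by (rule sum_bounded_below) (rule p_ge)
  then have "D * (6 / sqrt (real L)) \<le> 1" by (simp add: sum_p D_def add.commute)
  then have DL: "6 * D \<le> sqrt (real L)" using L by (simp add: field_simps)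
  have Dx: "0 < D * x" using D x0 by simp
  then have "s < D" using s kD by linarith
  then have D6: "6 < D" using s6 by simp
  \<comment> \<open>One factor sqrt L is bounded below by 6 D, the other by 36, since D > 6. This
    gives D \<le> L / 7 for the binomial estimate and later the comparison of L with n.\<close>
  have L216: "216 * D \<le> real L"
  proof -
    have "(6 * D) * 36 \<le> sqrt (real L) * sqrt (real L)"
      using DL D6 by (intro mult_mono) auto
    then show ?thesis by simp
  qed
  have "k * (6 / sqrt (real L)) \<le> x"
    unfolding k_def x_def by (rule sum_bounded_below) (rule p_ge)
  then have kx: "6 * k \<le> x * sqrt (real L)" using L by (simp add: field_simps)
  \<comment> \<open>Here s \<le> k, and each of the k states of A has probability at least 6 / sqrt
    L. The matching bound with 1 - x uses s \<le> D (1 - x) and 6 D \<le> sqrt L; their product is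
    the required bound of s by a sixth of the standard deviation.\<close>
  have "6 * s \<le> x * sqrt (real L)" using kx s Dx by linarith
  moreover have "6 * s \<le> (1 - x) * sqrt (real L)"
  proof -
    have "6 * s \<le> 6 * D * (1 - x)" using sD by simp
    also have "\<dots> \<le> sqrt (real L) * (1 - x)" using DL x1 by (intro mult_right_mono) auto
    finally show ?thesis by (simp add: mult.commute)
  qed
  ultimately have "(6 * s) * (6 * s) \<le> (x * sqrt (real L)) * ((1 - x) * sqrt (real L))"
    by (rule mult_mono) (use s6 x0 in auto)
  then have s36: "36 * s\<^sup>2 \<le> real L * x * (1 - x)"
    by (simp add: power2_eq_square mult_ac)

  define a where "a = (\<Sum>j\<in>A. Suc (N j))"
  \<comment> \<open>The Dirichlet parameters over A add up to \<open>a\<close>, and the half-space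
    has the probability of fewer than \<open>a\<close> successes, that is, of at most
    \<open>h\<close>.\<close>
  define h where "h = a - 1"
  have "0 < a" unfolding a_def using A_ne by (intro sum_pos) auto
  then have ah: "a = Suc h" by (simp add: h_def)
  have "real a = real n * x + k"
    by (simp add: a_def x_def k_def sum.distrib N_eq sum_distrib_left)
  \<comment> \<open>Substituting n = L - D + 1 and k = s + D x in h = n x + k - 1 cancels D
    x.\<close>
  then have h: "real h = real L * x + s + x - 1"
    using ah s by (simp add: L_def D_def algebra_simps)
  have "a \<le> (\<Sum>j\<in>UNIV. Suc (N j))"
    unfolding a_def by (rule sum_mono2) auto
  also have "\<dots> = Suc L" by (simp only: sum_Suc) (simp add: L_def n_def)
  finally have hL: "h \<le> L" using ah by simp

  define H where "H = {y :: real ^ 'd. x < (\<Sum>j\<in>A. simplex_point y $ j)}"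
  have "1 / 2 + 3 / 25 * s / sqrt (real L) \<le> (\<Sum>i\<le>h. Bernstein L i x)"
    by (rule Bernstein_sum_ge[OF x0 x1 h hL s6 sD _ s36]) (use L216 D in simp)
  also have "\<dots> = measure pi_d H"
    using measure_dirichlet_halfspace[OF N_pos A_ne A_ne' x0 x1]
    by (simp add: pi_d H_def a_def[symmetric] ah lessThan_Suc_atMost L_def n_def)
  finally have pi: "1 / 2 + 3 / 25 * s / sqrt (real L) \<le> measure pi_d H" .

  \<comment> \<open>The mass of A is affine in the d free coordinates, and \<open>l\<close> is its
    linear part. As \<theta>(A) equals x at the Gaussian mean, H is the half-space whose boundary
    passes through that mean.\<close>
  define l where "l y = (\<Sum>j\<in>A. simplex_dir y $ j)" for y :: "real ^ 'd"
  have "linear l"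
  proof -
    have "simplex_dir (y + z) $ j = simplex_dir y $ j + simplex_dir z $ j"
      "simplex_dir (r *\<^sub>R y) $ j = r * simplex_dir y $ j" for y z :: "real ^ 'd" and r j
      by (cases j; simp add: sum.distrib sum_distrib_left)+
    then show ?thesis
      by (intro linearI) (simp_all add: l_def sum.distrib sum_distrib_left)
  qed
  have "(\<Sum>j\<in>A. simplex_point y $ j) - (\<Sum>j\<in>A. simplex_point z $ j) = l y - l z" for y z :: "real ^ 'd"
  proof -
    have "simplex_point y $ j - simplex_point z $ j = simplex_dir y $ j - simplex_dir z $ j" for j
      by (cases j) simp_all
    then show ?thesis by (simp add: l_def sum_subtractf[symmetric])
  qed
  from this[of _ "drop0 p"] have "(\<Sum>j\<in>A. simplex_point y $ j) = x + (l y - l (drop0 p))" for y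
    by (simp add: simplex_point_p x_def diff_eq_eq add.commute)
  then have "H = {y. l (drop0 p) < l y}"
    by (simp add: H_def)
  then have ga: "measure gamma_d H \<le> 1 / 2"
    unfolding gamma(2) using measure_gaussian_halfspace_le[OF \<open>linear l\<close>] by simp

  have "H \<in> sets pi_d"
  proof -
    have [measurable]: "simplex_point \<in> borel \<rightarrow>\<^sub>M (borel :: (real ^ ('d option)) measure)"
      by (rule borel_measurable_simplex_point)
    have "H \<in> sets borel" unfolding H_def by measurable
    then show ?thesis by (simp add: pi_d marginal0_def)
  qed
  then have "measure pi_d H - measure gamma_d H \<le> tv_dist pi_d gamma_d"
    using prob_space_dirichlet[OF N_pos] prob_space_gaussian by (intro tv_dist_ge) (auto simp: pi_d gamma(2))
  then have tv: "3 / 25 * s / sqrt (real L) \<le> tv_dist pi_d gamma_d"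
    using pi ga by linarith

  have "real n = real L - real CARD('d)" by (simp add: L_def)
  \<comment> \<open>In fact L / n \<le> 216/215; the factor 27/25 is chosen so that the constants
    combine to 1/9.\<close>
  then have "real L \<le> (27 / 25)\<^sup>2 * real n"
    using L216 by (simp add: D_def power2_eq_square)
  then have "sqrt (real L) \<le> 27 / 25 * sqrt (real n)"
    by (metis real_sqrt_le_mono real_sqrt_mult real_sqrt_abs abs_numeral abs_divide)
  then have "D * sqrt (real L) \<le> D * (27 / 25 * sqrt (real n))"
    using D by (intro mult_left_mono) auto
  moreover have "real CARD('d) * sqrt (real L) \<le> D * sqrt (real L)"
    by (intro mult_right_mono) (auto simp: D_def)
  ultimately have "real CARD('d) * sqrt (real L) \<le> 27 / 25 * D * sqrt (real n)" by simp
  then have "real CARD('d) / sqrt (real n) \<le> 27 / 25 * D / sqrt (real L)"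
    using L n_pos by (simp add: divide_le_eq le_divide_eq mult_ac)
  then have "1 / 9 * tv_unif * (real CARD('d) / sqrt (real n)) \<le> 1 / 9 * tv_unif * (27 / 25 * D / sqrt (real L))"
    by (intro mult_left_mono) (auto simp: tv1 sum_nonneg)
  also have "\<dots> = 3 / 25 * s / sqrt (real L)" by (simp add: s_def)
  also note tv
  finally have "1 / 9 * tv_unif * (real CARD('d) / sqrt (real n)) \<le> tv_dist pi_d gamma_d" .
  then show ?thesis
    using tv1 gamma(1) unfolding multinomial_cov_def by (intro conjI)
qed

end
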